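(* Let $n\ge 0$ and let $G$ be an $(n+1)$-connected chordal graph. If $G$ cannot be folded onto a clique of size $n+2$, then $\mathcal{N}(G)$ is (topologically) $n$-connected.
   Context: Graphs are finite, undirected, without loops or multiple edges. A graph $G$ is $k$-connected if for any two distinct vertices $x,y$ there are at least $k$ internally disjoint $xy$-paths (pairwise sharing only the vertices $x,y$; a single edge $xy$ counts as one path); a $k$-connected graph with $k\ge1$ is understood to have at least two vertices. A graph is chordal if it has no induced subgraph isomorphic to a cycle $C_k$ with $k\ge 4$. If $u\ne v$ are vertices of $G$ with $N_G(u)\subseteq N_G(v)$ (where $N_G(\cdot)$ is the set of neighbours), the graph $G-\{u\}$ is called a fold of $G$. $G$ is folded onto $H$ if $H$ is obtained from $G$ by a finite (possibly empty) sequence of successive folds. A clique of size $m$ is a complete graph on $m$ vertices. The neighbourhood complex $\mathcal{N}(G)$ is the simplicial complex whose simplices are the subsets $\sigma\subseteq V(G)$ whose elements have a common neighbour in $G$. A nonempty topological space $X$ is $n$-connected if every map from $S^m$ to $X$ extends to a map from $D^{m+1}$ to $X$, for $m=0,1,\dots,n$; for a simplicial complex this refers to its geometric realization. *)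

theory Defs
  imports "Graph_Theory.Graph_Theory" "HOL-Analysis.Analysis"
begin

text \<open>
  A finite simple undirected graph is a \<open>pre_digraph\<close> satisfying the locale predicate
  \<open>graph\<close> of \<open>Graph_Theory\<close>: finite, symmetric, without loops or parallel arcs,
  so that every undirected edge is a pair of opposite arcs.
\<close>

section \<open>Graphs\<close>

text \<open>
  A path is given by its list of vertices (\<open>vpath\<close>), which in a simple graph determines its
  edges; distinct elements of \<open>P\<close> are therefore distinct paths, and the edge \<open>xy\<close>, i.e. the
  list \<open>[x, y]\<close>, is counted at most once.
\<close>

definition internally_disjoint_paths ::
    "('a, 'b) pre_digraph \<Rightarrow> 'a \<Rightarrow> 'a \<Rightarrow> 'a vwalk set \<Rightarrow> bool" where
  "internally_disjoint_paths G x y P \<longleftrightarrow>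
     (\<forall>p\<in>P. vpath p G \<and> hd p = x \<and> last p = y) \<and>
     (\<forall>p\<in>P. \<forall>q\<in>P. p \<noteq> q \<longrightarrow> set p \<inter> set q = {x, y})"

definition k_connected :: "nat \<Rightarrow> ('a, 'b) pre_digraph \<Rightarrow> bool" where
  "k_connected k G \<longleftrightarrow>
     (1 \<le> k \<longrightarrow> 2 \<le> card (verts G)) \<and>
     (\<forall>x\<in>verts G. \<forall>y\<in>verts G. x \<noteq> y \<longrightarrow>
        (\<exists>P. finite P \<and> k \<le> card P \<and> internally_disjoint_paths G x y P))"

text \<open>The cycle on \<open>{0, \<dots>, k - 1}\<close>; it is only used for \<open>k \<ge> 4\<close>.\<close>

definition cycle_graph :: "nat \<Rightarrow> nat pair_pre_digraph" where
  "cycle_graph k =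
     \<lparr> pverts = {..<k},
       parcs = {(i, j). i < k \<and> j < k \<and> (j = (i + 1) mod k \<or> i = (j + 1) mod k)} \<rparr>"

definition chordal :: "('a, 'b) pre_digraph \<Rightarrow> bool" where
  "chordal G \<longleftrightarrow>
     \<not> (\<exists>k H. 4 \<le> k \<and> induced_subgraph H G \<and> digraph_iso H (with_proj (cycle_graph k)))"

definition neighbours :: "('a, 'b) pre_digraph \<Rightarrow> 'a \<Rightarrow> 'a set" where
  "neighbours G v = {w \<in> verts G. v \<rightarrow>\<^bsub>G\<^esub> w}"

definition is_fold :: "('a, 'b) pre_digraph \<Rightarrow> ('a, 'b) pre_digraph \<Rightarrow> bool" where
  "is_fold G H \<longleftrightarrow>
     (\<exists>u\<in>verts G. \<exists>v\<in>verts G. u \<noteq> v \<and> neighbours G u \<subseteq> neighbours G v \<and>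
        H = pre_digraph.del_vert G u)"

definition folds_onto :: "('a, 'b) pre_digraph \<Rightarrow> ('a, 'b) pre_digraph \<Rightarrow> bool" where
  "folds_onto = is_fold\<^sup>*\<^sup>*"

section \<open>The neighbourhood complex and its topology\<close>

definition neighbourhood_complex :: "('a, 'b) pre_digraph \<Rightarrow> 'a set set" where
  "neighbourhood_complex G =
     {\<sigma>. \<sigma> \<subseteq> verts G \<and> (\<exists>w\<in>verts G. \<forall>v\<in>\<sigma>. w \<in> neighbours G v)}"

text \<open>
  Points of the realization are given by barycentric coordinates, extended by \<open>0\<close> to the whole
  vertex type; the empty simplex contributes no point. The product topology is the usual topology
  of the realization only for a complex with finitely many vertices.
\<close>

definition geometric_realization :: "'a set set \<Rightarrow> ('a \<Rightarrow> real) topology" where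
  "geometric_realization K =
     subtopology (powertop_real UNIV)
       {x. (\<forall>v. 0 \<le> x v) \<and> {v. x v \<noteq> 0} \<in> K \<and> (\<Sum>v | x v \<noteq> 0. x v) = 1}"

text \<open>The closed unit disk \<open>D\<^sup>d\<close>; the boundary of \<open>disk (m + 1)\<close> is \<open>nsphere m\<close>.\<close>

definition disk :: "nat \<Rightarrow> (nat \<Rightarrow> real) topology" where
  "disk d = subtopology (Euclidean_space d) {x. (\<Sum>i<d. x i ^ 2) \<le> 1}"

definition n_connected_space :: "nat \<Rightarrow> 'a topology \<Rightarrow> bool" where
  "n_connected_space n X \<longleftrightarrow>
     topspace X \<noteq> {} \<and>
     (\<forall>m\<le>n. \<forall>f. continuous_map (nsphere m) X f \<longrightarrow>
        (\<exists>g. continuous_map (disk (m + 1)) X g \<and> (\<forall>x\<in>topspace (nsphere m). g x = f x)))"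

end

theory Submission
  imports Defs
begin

text \<open>
  If \<open>G\<close> has no clique with \<open>n + 3\<close> vertices, every simplicial vertex \<open>u\<close> has degree exactly
  \<open>n + 1\<close>; by chordality and connectivity some vertex outside \<open>N[u]\<close> is adjacent to all of
  \<open>N(u)\<close>, so \<open>u\<close> can be folded away until \<open>n + 2\<close> vertices are left, and these form a clique.

  Otherwise fix a clique \<open>Q\<close> with \<open>n + 3\<close> vertices and delete simplicial vertices \<open>u\<close> outside \<open>Q\<close>
  one at a time. With \<open>K = N(u)\<close>, the complex \<open>N(G)\<close> arises from \<open>N(G - u)\<close> by adding the simplex
  on \<open>K\<close> and then a cone with apex \<open>u\<close> over the union of the simplices \<open>N\<^sub>G\<^sub>-\<^sub>u(w)\<close>, \<open>w \<in> K\<close>.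
  Any \<open>n + 1\<close> of these simplices meet, so their union is \<open>(n - 1)\<close>-connected, and likewise for the
  intersection of \<open>N(G - u)\<close> with the simplex on \<open>K\<close>. Thus it remains to know that the union of
  two \<open>n\<close>-connected subcomplexes with \<open>(n - 1)\<close>-connected intersection is \<open>n\<close>-connected. For this
  a map on the boundary of a cube is deformed so that, on a fine grid, the trace of every cell on
  the boundary is sent into one of the two subcomplexes; it is then extended cell by cell.
\<close>

section \<open>Extending maps from the boundary of a box\<close>

text \<open>The number \<open>n + 3\<close> is forced. The neighbourhood complex of a complete graph
  on \<open>m\<close> vertices consists of all proper subsets, so it is the boundary of a simplex
  and a sphere of dimension \<open>m - 2\<close>. For \<open>m = n + 2\<close> this is the
  \<open>n\<close>-sphere, which is not \<open>n\<close>-connected; for \<open>m = n + 3\<close> it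
  is \<open>n\<close>-connected and can start an induction. Deleting an arbitrary vertex could
  create a small separator. A simplicial vertex is safe, since a walk through it can be shortcut
  between two of its neighbours. The delicate case is a neighbourhood \<open>K\<close> with exactly
  \<open>n + 1\<close> vertices. For a proper subset of \<open>K\<close> any remaining vertex of
  \<open>K\<close> is a common neighbour, but for \<open>K\<close> itself one has to be found
  outside. The gluing statement is proved for maps directly and in all dimensions at once, rather
  than through homology and the fundamental group. Cubes take the place of balls because they
  subdivide into cubes whose faces are cubes again.\<close>

definition unit_box :: "(nat \<Rightarrow> real) \<Rightarrow> nat set \<Rightarrow> (nat \<Rightarrow> real) set" where
  "unit_box p J = {x. \<forall>i. p i \<le> x i \<and> x i \<le> p i + (if i \<in> J then 1 else 0)}"

definition box_bdry :: "(nat \<Rightarrow> real) \<Rightarrow> nat set \<Rightarrow> (nat \<Rightarrow> real) set" where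
  "box_bdry p J = {x \<in> unit_box p J. \<exists>i\<in>J. x i = p i \<or> x i = p i + 1}"

text \<open>
  A nonempty space is \<open>n\<close>-connected if it is \<open>box_connected (n + 1)\<close>; the empty box boundary in
  dimension \<open>0\<close> makes \<open>box_connected 0\<close> express nonemptiness.
\<close>

definition box_connected :: "nat \<Rightarrow> 'b::topological_space set \<Rightarrow> bool" where
  "box_connected k X \<longleftrightarrow>
     (\<forall>p J f. finite J \<and> card J \<le> k \<and> continuous_on (box_bdry p J) f \<and> f \<in> box_bdry p J \<rightarrow> X \<longrightarrow>
        (\<exists>g. continuous_on (unit_box p J) g \<and> g \<in> unit_box p J \<rightarrow> X \<and> (\<forall>x\<in>box_bdry p J. g x = f x)))"

lemma box_connectedD:
  assumes "box_connected k X" "finite J" "card J \<le> k"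
    "continuous_on (box_bdry p J) f" "f \<in> box_bdry p J \<rightarrow> X"
  obtains g where "continuous_on (unit_box p J) g" "g \<in> unit_box p J \<rightarrow> X" "\<And>x. x \<in> box_bdry p J \<Longrightarrow> g x = f x"
  using assms unfolding box_connected_def by metis

lemma box_connected_mono: "box_connected k X \<Longrightarrow> j \<le> k \<Longrightarrow> box_connected j X"
  unfolding box_connected_def by (meson order_trans)

lemma box_bdry_subset: "box_bdry p J \<subseteq> unit_box p J"
  by (auto simp: box_bdry_def)

lemma continuous_on_coord [continuous_intros]: "continuous_on S (\<lambda>x. x i)"
  for S :: "('i \<Rightarrow> 'c::topological_space) set"
  by (rule continuous_on_product_then_coordinatewise[OF continuous_on_id])

lemma continuous_on_coord': "continuous_on S f \<Longrightarrow> continuous_on S (\<lambda>x. f x i)"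
  for f :: "'d::topological_space \<Rightarrow> 'i \<Rightarrow> 'c::topological_space"
  by (rule continuous_on_product_then_coordinatewise)

lemma closed_unit_box: "closed (unit_box p J)"
proof -
  have "unit_box p J = (\<Inter>i. {x. p i \<le> x i} \<inter> {x. x i \<le> p i + (if i \<in> J then 1 else 0)})"
    by (auto simp: unit_box_def split: if_splits)
  also have "closed \<dots>"
    by (intro closed_INT ballI closed_Int closed_Collect_le continuous_intros continuous_on_id)
  finally show ?thesis .
qed

lemma closed_box_bdry:
  assumes "finite J"
  shows "closed (box_bdry p J)"
proof -
  have "box_bdry p J = unit_box p J \<inter> (\<Union>i\<in>J. {x. x i = p i} \<union> {x. x i = p i + 1})"
    by (auto simp: box_bdry_def)
  also have "closed \<dots>"
    using assms
    by (intro closed_Int closed_unit_box closed_UN ballI closed_Un closed_Collect_eq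
        continuous_intros continuous_on_id)
  finally show ?thesis .
qed

lemma compact_box_bdry:
  assumes "finite J"
  shows "compact (box_bdry p J)"
proof -
  let ?P = "PiE UNIV (\<lambda>i. {p i .. p i + 1})"
  have "compactin (product_topology (\<lambda>i. euclidean) UNIV) ?P"
    by (subst compactin_PiE) (auto simp: compactin_euclidean_iff)
  then have "compact ?P"
    by (simp add: euclidean_product_topology compactin_euclidean_iff)
  moreover have "box_bdry p J \<subseteq> ?P"
    by (auto simp: box_bdry_def unit_box_def PiE_def split: if_splits)
       (smt (verit, best))+
  ultimately show ?thesis
    using closed_box_bdry[OF assms] by (metis closed_Int_compact inf.absorb1)
qed

lemma continuous_on_Max:
  fixes f :: "'i \<Rightarrow> 'b::topological_space \<Rightarrow> real"
  assumes "finite J" "J \<noteq> {}" "\<And>i. i \<in> J \<Longrightarrow> continuous_on S (f i)"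
  shows "continuous_on S (\<lambda>x. Max ((\<lambda>i. f i x) ` J))"
  using assms
proof (induction J rule: finite_ne_induct)
  case (singleton i)
  then show ?case by simp
next
  case (insert i J)
  have "(\<lambda>x. Max ((\<lambda>i. f i x) ` insert i J)) = (\<lambda>x. max (f i x) (Max ((\<lambda>i. f i x) ` J)))"
    using insert by (auto simp: fun_eq_iff)
  then show ?case
    using insert by (auto intro!: continuous_intros)
qed

text \<open>The box is shrunk radially to half its size; the homotopy is run on the collar.\<close>

lemma box_homotopy_extension:
  fixes g' :: "(nat \<Rightarrow> real) \<Rightarrow> 'b::topological_space"
  assumes J: "finite J"
    and g': "continuous_on (unit_box p J) g'" "g' \<in> unit_box p J \<rightarrow> X"
    and h: "continuous_on ({0..1} \<times> box_bdry p J) h" "h \<in> {0..1} \<times> box_bdry p J \<rightarrow> X"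
    and h0: "\<And>x. x \<in> box_bdry p J \<Longrightarrow> h (0, x) = g' x"
  obtains g where "continuous_on (unit_box p J) g" "g \<in> unit_box p J \<rightarrow> X"
    "\<And>x. x \<in> box_bdry p J \<Longrightarrow> g x = h (1::real, x)"
proof (cases "J = {}")
  case True
  then show ?thesis using that[of g'] g' by (simp add: box_bdry_def)
next
  case False
  \<comment> \<open>\<open>c\<close> is the centre and \<open>\<rho>\<close> the distance from it in
    the maximum norm, scaled to be \<open>1\<close> on the boundary. \<open>y\<close> doubles the
    inner box \<open>\<rho> \<le> 1/2\<close> and projects the collar radially to the boundary; the
    \<open>max\<close> covers both with one formula. The time \<open>2 * \<rho> - 1\<close> runs
    from \<open>0\<close> to \<open>1\<close> across the collar.\<close>
  define c where "c i = p i + (if i \<in> J then 1/2 else 0)" for i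
  define \<rho> where "\<rho> x = Max ((\<lambda>i. 2 * \<bar>x i - c i\<bar>) ` J)" for x :: "nat \<Rightarrow> real"
  define y where "y x i = c i + (x i - c i) / max (\<rho> x) (1/2)" for x i
  define g where "g x = (if \<rho> x \<le> 1/2 then g' (y x) else h (2 * \<rho> x - 1, y x))" for x
  have \<rho>_ge: "2 * \<bar>x i - c i\<bar> \<le> \<rho> x" if "i \<in> J" for x i
    unfolding \<rho>_def using J that by (intro Max_ge) auto
  have \<rho>_att: "\<exists>i\<in>J. \<rho> x = 2 * \<bar>x i - c i\<bar>" for x
  proof -
    have "\<rho> x \<in> (\<lambda>i. 2 * \<bar>x i - c i\<bar>) ` J"
      unfolding \<rho>_def using J False by (intro Max_in) auto
    then show ?thesis by auto
  qed
  have cont_\<rho>: "continuous_on S \<rho>" for S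
    unfolding \<rho>_def[abs_def] using J False
    by (intro continuous_on_Max continuous_intros continuous_on_id) auto
  have cont_y: "continuous_on S y" for S
    unfolding y_def
    by (intro continuous_on_coordinatewise_then_product continuous_intros continuous_on_id cont_\<rho>)
      (auto simp: max_def)
  have box_iff: "x \<in> unit_box p J \<longleftrightarrow> (\<forall>i\<in>J. 2 * \<bar>x i - c i\<bar> \<le> 1) \<and> (\<forall>i. i \<notin> J \<longrightarrow> x i = c i)" for x
    unfolding unit_box_def c_def by (auto simp: abs_le_iff) (smt (verit) field_sum_of_halves)+
  have bdry_iff: "x \<in> box_bdry p J \<longleftrightarrow> x \<in> unit_box p J \<and> (\<exists>i\<in>J. 2 * \<bar>x i - c i\<bar> = 1)" for x
    unfolding box_bdry_def c_def by (auto simp: abs_if) (smt (verit) field_sum_of_halves)+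
  have rho_y: "2 * \<bar>y x i - c i\<bar> = (2 * \<bar>x i - c i\<bar>) / max (\<rho> x) (1/2)" for x i
    unfolding y_def by (simp add: abs_mult)
  have y_box: "y x \<in> unit_box p J" if "x \<in> unit_box p J" for x
    unfolding box_iff rho_y
  proof safe
    fix i assume "i \<in> J"
    from \<rho>_ge[OF this, of x] show "(2 * \<bar>x i - c i\<bar>) / max (\<rho> x) (1/2) \<le> 1"
      by (simp add: pos_divide_le_eq less_max_iff_disj le_max_iff_disj)
  next
    fix i assume "i \<notin> J"
    then show "y x i = c i" using that box_iff by (auto simp: y_def)
  qed
  have y_bdry: "y x \<in> box_bdry p J" if x: "x \<in> unit_box p J" "1/2 \<le> \<rho> x" for x
  proof -
    from \<rho>_att[of x] obtain i where i: "i \<in> J" "\<rho> x = 2 * \<bar>x i - c i\<bar>" by auto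
    then have "2 * \<bar>y x i - c i\<bar> = 1"
      using x(2) unfolding rho_y by (auto simp: max_def)
    then show ?thesis using bdry_iff y_box[OF x(1)] i by blast
  qed
  have \<rho>_le1: "\<rho> x \<le> 1" if "x \<in> unit_box p J" for x
    using \<rho>_att[of x] that box_iff by auto
  have "continuous_on ({x \<in> unit_box p J. \<rho> x \<le> 1/2} \<union> {x \<in> unit_box p J. 1/2 \<le> \<rho> x}) g"
    unfolding g_def
  proof (rule continuous_on_cases)
    show "closed {x \<in> unit_box p J. \<rho> x \<le> 1/2}"
      using closed_unit_box by (intro closed_Collect_conj closed_Collect_le cont_\<rho> continuous_intros) auto
    show "closed {x \<in> unit_box p J. 1/2 \<le> \<rho> x}"
      using closed_unit_box by (intro closed_Collect_conj closed_Collect_le cont_\<rho> continuous_intros) auto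
    show "continuous_on {x \<in> unit_box p J. \<rho> x \<le> 1/2} (\<lambda>x. g' (y x))"
      by (rule continuous_on_compose2[OF g'(1) cont_y]) (use y_box in auto)
    show "continuous_on {x \<in> unit_box p J. 1/2 \<le> \<rho> x} (\<lambda>x. h (2 * \<rho> x - 1, y x))"
      by (rule continuous_on_compose2[OF h(1)])
        (use y_bdry \<rho>_le1 in \<open>auto intro!: continuous_intros cont_\<rho> cont_y\<close>)
    show "\<forall>x. x \<in> {x \<in> unit_box p J. \<rho> x \<le> 1/2} \<and> \<not> \<rho> x \<le> 1/2 \<or>
          x \<in> {x \<in> unit_box p J. 1/2 \<le> \<rho> x} \<and> \<rho> x \<le> 1/2 \<longrightarrow> g' (y x) = h (2 * \<rho> x - 1, y x)"
    proof (intro allI impI)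
      fix x assume *: "x \<in> {x \<in> unit_box p J. \<rho> x \<le> 1/2} \<and> \<not> \<rho> x \<le> 1/2 \<or>
          x \<in> {x \<in> unit_box p J. 1/2 \<le> \<rho> x} \<and> \<rho> x \<le> 1/2"
      then have "\<rho> x = 1/2" "x \<in> unit_box p J" by auto
      moreover from this have "2 * \<rho> x - 1 = 0" by simp
      ultimately show "g' (y x) = h (2 * \<rho> x - 1, y x)"
        using h0[of "y x"] y_bdry[of x] by simp
    qed
  qed
  moreover have "{x \<in> unit_box p J. \<rho> x \<le> 1/2} \<union> {x \<in> unit_box p J. 1/2 \<le> \<rho> x} = unit_box p J"
    by auto
  ultimately have "continuous_on (unit_box p J) g" by simp
  moreover have "g \<in> unit_box p J \<rightarrow> X"
    using g'(2) h(2) y_box y_bdry \<rho>_le1 unfolding g_def by (auto simp: Pi_iff)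
  moreover have "g x = h (1, x)" if "x \<in> box_bdry p J" for x
  proof -
    from that bdry_iff obtain i where "i \<in> J" "2 * \<bar>x i - c i\<bar> = 1" and xb: "x \<in> unit_box p J" by auto
    with \<rho>_ge[of i x] \<rho>_le1[of x] have "\<rho> x = 1" by auto
    then show ?thesis by (simp add: g_def y_def[abs_def])
  qed
  ultimately show ?thesis using that by blast
qed

section \<open>Cubical grids\<close>

text \<open>The metric on functions is a series with weights \<open>(1/2)^n\<close>, whose sum is
  the factor \<open>2\<close>. This converts the mesh of a grid into a bound on distances.\<close>

lemma dist_fun_le:
  fixes x y :: "nat \<Rightarrow> real"
  assumes "\<And>i. \<bar>x i - y i\<bar> \<le> \<delta>"
  shows "dist x y \<le> 2 * \<delta>"
proof -
  let ?t = "\<lambda>n. (1/2::real)^n * min (dist (x (from_nat n)) (y (from_nat n))) 1"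
  have gs: "(\<lambda>n. (1/2::real)^n) sums 2"
    using geometric_sums[of "1/2::real"] by simp
  have le: "?t n \<le> \<delta> * (1/2)^n" for n
    using assms[of "from_nat n"] by (simp add: dist_real_def min.coboundedI1 mult.commute)
  have s: "summable (\<lambda>n. \<delta> * (1/2::real)^n)"
    using gs sums_summable summable_mult by blast
  have "summable ?t"
    by (rule summable_comparison_test'[OF s, of 0]) (use le in \<open>auto simp: abs_mult min_def\<close>)
  then have "dist x y \<le> (\<Sum>n. \<delta> * (1/2::real)^n)"
    unfolding dist_fun_def using s le by (intro suminf_le) auto
  also have "\<dots> = 2 * \<delta>"
    using sums_unique[OF sums_mult[OF gs, of \<delta>]] by simp
  finally show ?thesis .
qed

definition cell :: "(nat \<Rightarrow> int) \<times> nat set \<Rightarrow> (nat \<Rightarrow> real) set" where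
  "cell e = unit_box (\<lambda>i. real_of_int (fst e i)) (snd e)"

definition cell_bdry :: "(nat \<Rightarrow> int) \<times> nat set \<Rightarrow> (nat \<Rightarrow> real) set" where
  "cell_bdry e = box_bdry (\<lambda>i. real_of_int (fst e i)) (snd e)"

definition big_box :: "nat \<Rightarrow> nat set \<Rightarrow> (nat \<Rightarrow> real) set" where
  "big_box N J = {x. \<forall>i. 0 \<le> x i \<and> x i \<le> (if i \<in> J then real N else 0)}"

definition big_bdry :: "nat \<Rightarrow> nat set \<Rightarrow> (nat \<Rightarrow> real) set" where
  "big_bdry N J = {x \<in> big_box N J. \<exists>i\<in>J. x i = 0 \<or> x i = real N}"

definition faces :: "(nat \<Rightarrow> int) \<times> nat set \<Rightarrow> ((nat \<Rightarrow> int) \<times> nat set) set" where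
  "faces e = (\<Union>i\<in>snd e. {(fst e, snd e - {i}), ((fst e)(i := fst e i + 1), snd e - {i})})"

text \<open>In a free direction the corner stays below \<open>N\<close>, so that the far end remains
  in the box; in a frozen direction of \<open>J\<close> the value \<open>N\<close> is allowed. This
  makes the grid closed under \<open>faces\<close>.\<close>

definition grid :: "nat \<Rightarrow> nat set \<Rightarrow> ((nat \<Rightarrow> int) \<times> nat set) set" where
  "grid N J = {(z, I). I \<subseteq> J \<and> (\<forall>i. if i \<in> I then 0 \<le> z i \<and> z i < int N
                  else if i \<in> J then 0 \<le> z i \<and> z i \<le> int N else z i = 0)}"

lemma cell_iff: "x \<in> cell (z, I) \<longleftrightarrow> (\<forall>i. real_of_int (z i) \<le> x i \<and> x i \<le> real_of_int (z i) + (if i \<in> I then 1 else 0))"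
  by (auto simp: cell_def unit_box_def)

lemma cell_bdry_iff: "x \<in> cell_bdry (z, I) \<longleftrightarrow>
    x \<in> cell (z, I) \<and> (\<exists>i\<in>I. x i = real_of_int (z i) \<or> x i = real_of_int (z i) + 1)"
  by (auto simp: cell_def cell_bdry_def box_bdry_def)

lemma cell_bdry_faces: "cell_bdry e \<subseteq> \<Union> (cell ` faces e)"
proof
  obtain z I where e: "e = (z, I)" by fastforce
  fix x assume "x \<in> cell_bdry e"
  then obtain i where x: "x \<in> cell (z, I)" "i \<in> I" "x i = real_of_int (z i) \<or> x i = real_of_int (z i) + 1"
    by (auto simp: e cell_bdry_iff)
  then have "x \<in> cell (z, I - {i}) \<or> x \<in> cell (z(i := z i + 1), I - {i})"
    unfolding cell_iff by (auto split: if_splits)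
  then show "x \<in> \<Union> (cell ` faces e)"
    using x(2) unfolding faces_def e by auto
qed

lemma face_subset:
  assumes "d \<in> faces e"
  shows "cell d \<subseteq> cell e"
proof
  fix x assume x: "x \<in> cell d"
  obtain z I where zI: "e = (z, I)" by fastforce
  then obtain i w where i: "i \<in> I" "d = (w, I - {i})" "w = z \<or> w = z(i := z i + 1)"
    using assms by (auto simp: faces_def)
  have xw: "real_of_int (w j) \<le> x j" "x j \<le> real_of_int (w j) + (if j \<in> I - {i} then 1 else 0)" for j
    using x cell_iff[of x w "I - {i}"] i(2) by blast+
  show "x \<in> cell e"
    unfolding zI cell_iff
  proof
    fix j
    show "real_of_int (z j) \<le> x j \<and> x j \<le> real_of_int (z j) + (if j \<in> I then 1 else 0)"
      using i(1,3) xw[of j] by (cases "j = i") auto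
  qed
qed

text \<open>An interior point of \<open>(z, I)\<close> has non-integral coordinates exactly in the
  directions of \<open>I\<close>. Any other cell containing it must be free in all of these, hence
  \<open>I = I'\<close> by dimension, and the corners then agree as well.\<close>

lemma cells_meet_in_bdry:
  assumes "finite I'" "card I' \<le> card I" "(z, I) \<noteq> (z', I')" "x \<in> cell (z, I)" "x \<in> cell (z', I')"
  shows "x \<in> cell_bdry (z, I)"
proof (rule ccontr)
  assume neg: "x \<notin> cell_bdry (z, I)"
  have inner: "real_of_int (z i) < x i \<and> x i < real_of_int (z i) + 1" if "i \<in> I" for i
    using neg that assms(4) unfolding cell_bdry_iff cell_iff by (metis order_le_less)
  have outer: "x i = real_of_int (z i)" if "i \<notin> I" for i
    using that assms(4) unfolding cell_iff by (smt (verit))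
  have outer': "x i = real_of_int (z' i)" if "i \<notin> I'" for i
    using that assms(5) unfolding cell_iff by (smt (verit))
  have "I \<subseteq> I'"
  proof
    fix i assume i: "i \<in> I"
    show "i \<in> I'"
    proof (rule ccontr)
      assume "i \<notin> I'"
      from outer'[OF this] inner[OF i] have "z i < z' i" "z' i < z i + 1" by linarith+
      then show False by linarith
    qed
  qed
  then have II: "I = I'" using assms(1,2) by (simp add: card_seteq)
  have "z i = z' i" for i
  proof (cases "i \<in> I")
    case True
    then have "x i \<le> real_of_int (z' i) + 1" "real_of_int (z' i) \<le> x i"
      using assms(5) II unfolding cell_iff by (metis (full_types))+
    with inner[OF True] show ?thesis by linarith
  next
    case False
    then show ?thesis using outer[OF False] outer'[of i] II by simp
  qed
  then show False using assms(3) II by auto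
qed

lemma grid_faces: "e \<in> grid N J \<Longrightarrow> faces e \<subseteq> grid N J"
proof -
  assume e: "e \<in> grid N J"
  obtain z I where zI: "e = (z, I)" by fastforce
  have I: "I \<subseteq> J" and z: "\<And>i. if i \<in> I then 0 \<le> z i \<and> z i < int N
                  else if i \<in> J then 0 \<le> z i \<and> z i \<le> int N else z i = 0"
    using e by (auto simp: grid_def zI)
  have "(z, I - {i}) \<in> grid N J \<and> (z(i := z i + 1), I - {i}) \<in> grid N J" if "i \<in> I" for i
  proof -
    have "if j \<in> I - {i} then 0 \<le> w j \<and> w j < int N
        else if j \<in> J then 0 \<le> w j \<and> w j \<le> int N else w j = 0"
      if "w = z \<or> w = z(i := z i + 1)" for w j
      using that z[of j] \<open>i \<in> I\<close> I by (auto split: if_splits)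
    then show ?thesis using I unfolding grid_def by blast
  qed
  then show ?thesis unfolding faces_def zI by auto
qed

lemma finite_grid:
  assumes "finite J"
  shows "finite (grid N J)"
proof (rule finite_subset)
  show "grid N J \<subseteq> {z. \<forall>i. (i \<in> J \<longrightarrow> z i \<in> {0..int N}) \<and> (i \<notin> J \<longrightarrow> z i = 0)} \<times> Pow J"
  proof
    fix e assume "e \<in> grid N J"
    then obtain z I where e: "e = (z, I)" and I: "I \<subseteq> J" and z: "\<And>i. if i \<in> I then 0 \<le> z i \<and> z i < int N
        else if i \<in> J then 0 \<le> z i \<and> z i \<le> int N else z i = 0"
      by (auto simp: grid_def)
    have "(i \<in> J \<longrightarrow> z i \<in> {0..int N}) \<and> (i \<notin> J \<longrightarrow> z i = 0)" for i
      using z[of i] I by (auto split: if_splits)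
    then show "e \<in> {z. \<forall>i. (i \<in> J \<longrightarrow> z i \<in> {0..int N}) \<and> (i \<notin> J \<longrightarrow> z i = 0)} \<times> Pow J"
      using e I by auto
  qed
  show "finite ({z::nat \<Rightarrow> int. \<forall>i. (i \<in> J \<longrightarrow> z i \<in> {0..int N}) \<and> (i \<notin> J \<longrightarrow> z i = 0)} \<times> Pow J)"
    using assms by (intro finite_cartesian_product finite_set_of_finite_funs) auto
qed

lemma grid_finite_snd: "finite J \<Longrightarrow> e \<in> grid N J \<Longrightarrow> finite (snd e)"
  by (auto simp: grid_def dest: finite_subset)

lemma card_faces: "finite (snd e) \<Longrightarrow> d \<in> faces e \<Longrightarrow> card (snd d) < card (snd e)"
  by (auto simp: faces_def intro!: psubset_card_mono)

text \<open>A frozen coordinate equal to \<open>0\<close> or \<open>N\<close> would put the whole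
  cell into the boundary of the big box. So a boundary point of the cell attains such a value in a
  free direction, at an end of the cell.\<close>

lemma cell_big_bdry:
  assumes e: "(z, I) \<in> grid N J" and nsub: "\<not> cell (z, I) \<subseteq> big_bdry N J"
    and sub: "cell (z, I) \<subseteq> big_box N J"
  shows "cell (z, I) \<inter> big_bdry N J \<subseteq> cell_bdry (z, I)"
proof
  fix x assume x: "x \<in> cell (z, I) \<inter> big_bdry N J"
  then obtain i where i: "i \<in> J" "x i = 0 \<or> x i = real N" by (auto simp: big_bdry_def)
  have z: "if i \<in> I then 0 \<le> z i \<and> z i < int N else 0 \<le> z i \<and> z i \<le> int N"
    using e i by (auto simp: grid_def split: if_splits)
  have xi: "real_of_int (z i) \<le> x i" "x i \<le> real_of_int (z i) + (if i \<in> I then 1 else 0)"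
    using x cell_iff[of x z I] by blast+
  have "i \<in> I"
  proof (rule ccontr)
    assume "i \<notin> I"
    then have "y i = x i" if "y \<in> cell (z, I)" for y
      using that xi unfolding cell_iff by (smt (verit))
    then have "cell (z, I) \<subseteq> big_bdry N J"
      using i sub unfolding big_bdry_def by (smt (verit) mem_Collect_eq subset_iff)
    with nsub show False by blast
  qed
  then have "x i = real_of_int (z i) \<or> x i = real_of_int (z i) + 1"
    using i xi z by (auto split: if_splits)
  then show "x \<in> cell_bdry (z, I)" using x \<open>i \<in> I\<close> by (auto simp: cell_bdry_iff)
qed

lemma grid_cell_subset: "e \<in> grid N J \<Longrightarrow> cell e \<subseteq> big_box N J"
proof
  assume e: "e \<in> grid N J"
  fix x assume x: "x \<in> cell e"
  obtain z I where zI: "e = (z, I)" by fastforce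
  have "0 \<le> x i \<and> x i \<le> (if i \<in> J then real N else 0)" for i
  proof -
    have "real_of_int (z i) \<le> x i" "x i \<le> real_of_int (z i) + (if i \<in> I then 1 else 0)"
      using x unfolding zI cell_iff by auto
    moreover have "if i \<in> I then i \<in> J \<and> 0 \<le> z i \<and> z i < int N
                  else if i \<in> J then 0 \<le> z i \<and> z i \<le> int N else z i = 0"
      using e unfolding zI grid_def by auto
    ultimately show ?thesis by (auto split: if_splits)
  qed
  then show "x \<in> big_box N J" by (auto simp: big_box_def)
qed

lemma big_box_cover:
  assumes "0 < N"
  shows "big_box N J \<subseteq> \<Union> (cell ` grid N J)"
proof
  fix x assume x: "x \<in> big_box N J"
  \<comment> \<open>The cap \<open>N - 1\<close> assigns points with a coordinate equal to
    \<open>N\<close> to the far end of the last cell.\<close>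
  define z where "z i = (if i \<in> J then min \<lfloor>x i\<rfloor> (int N - 1) else 0)" for i
  have xi: "0 \<le> x i" "x i \<le> (if i \<in> J then real N else 0)" for i
    using x by (auto simp: big_box_def)
  have "(z, J) \<in> grid N J"
    using xi assms by (auto simp: grid_def z_def)
  moreover have "x \<in> cell (z, J)"
    unfolding cell_iff
  proof
    fix i
    show "real_of_int (z i) \<le> x i \<and> x i \<le> real_of_int (z i) + (if i \<in> J then 1 else 0)"
      using xi[of i] by (auto simp: z_def min_def) linarith+
  qed
  ultimately show "x \<in> \<Union> (cell ` grid N J)" by blast
qed

lemma closed_cell: "closed (cell e)"
  unfolding cell_def by (rule closed_unit_box)

lemma closed_big_bdry:
  assumes "finite J"
  shows "closed (big_bdry N J)"
proof -
  have "big_bdry N J = (\<Inter>i. {x. 0 \<le> x i} \<inter> {x. x i \<le> (if i \<in> J then real N else 0)}) \<inter> (\<Union>i\<in>J. {x. x i = 0} \<union> {x. x i = real N})"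
    unfolding big_bdry_def big_box_def by blast
  also have "closed \<dots>"
    using assms by (intro closed_INT closed_Int closed_Collect_le closed_UN ballI closed_Un closed_Collect_eq
        continuous_intros continuous_on_id)
  finally show ?thesis .
qed

text \<open>
  The cells are added in order of increasing dimension, so that each new cell meets what is
  already there exactly in its boundary (or lies in the boundary of the big box).
\<close>

lemma cellwise_extension:
  fixes F :: "(nat \<Rightarrow> real) \<Rightarrow> 'b::topological_space"
  assumes J: "finite J" and F: "continuous_on (big_bdry N J) F"
    and D: "\<D> \<subseteq> grid N J" "\<And>e. e \<in> \<D> \<Longrightarrow> faces e \<subseteq> \<D>"
    and T: "\<And>e. e \<in> \<D> \<Longrightarrow> box_connected (card (snd e)) (T e)"
      "\<And>e d. e \<in> \<D> \<Longrightarrow> d \<in> faces e \<Longrightarrow> T d \<subseteq> T e"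
      "\<And>e. e \<in> \<D> \<Longrightarrow> F ` (cell e \<inter> big_bdry N J) \<subseteq> T e"
  shows "\<exists>G. continuous_on (big_bdry N J \<union> \<Union> (cell ` \<D>)) G \<and> (\<forall>x\<in>big_bdry N J. G x = F x) \<and>
             (\<forall>e\<in>\<D>. G ` cell e \<subseteq> T e)"
proof -
  have "finite \<D>" using D(1) finite_grid[OF J] finite_subset by blast
  then show ?thesis using D T
  proof (induction \<D> rule: finite_psubset_induct)
    case (psubset \<D>)
    show ?case
    proof (cases "\<D> = {}")
      case True
      then show ?thesis using F by auto
    next
      case False
      \<comment> \<open>A cell of maximal dimension is a face of no cell in \<open>\<D>\<close>, so
        \<open>\<D> - {e}\<close> is still closed under faces.\<close>
      obtain e where e: "e \<in> \<D>" and emax: "\<And>d. d \<in> \<D> \<Longrightarrow> card (snd d) \<le> card (snd e)"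
        using Max_in[of "(\<lambda>d. card (snd d)) ` \<D>"] Max_ge[of "(\<lambda>d. card (snd d)) ` \<D>"] psubset.hyps False
        by (smt (verit, ccfv_SIG) finite_imageI imageE image_eqI image_is_empty)
      let ?D = "\<D> - {e}" let ?Bd = "big_bdry N J" let ?S = "?Bd \<union> \<Union> (cell ` ?D)"
      have fin: "finite (snd d)" if "d \<in> \<D>" for d
        using that psubset.prems(1) grid_finite_snd[OF J] by blast
      have face': "faces d \<subseteq> ?D" if "d \<in> \<D>" for d
      proof -
        have "e \<notin> faces d" using card_faces[OF fin[OF that], of e] emax[OF that] by auto
        then show ?thesis using psubset.prems(2)[OF that] by blast
      qed
      have "\<exists>G. continuous_on ?S G \<and> (\<forall>x\<in>?Bd. G x = F x) \<and> (\<forall>e\<in>?D. G ` cell e \<subseteq> T e)"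
      proof (rule psubset.IH)
        show "?D \<subset> \<D>" using e by auto
        show "?D \<subseteq> grid N J" using psubset.prems(1) by auto
      qed (use psubset.prems face' in auto)
      then obtain G where G: "continuous_on ?S G" "\<forall>x\<in>?Bd. G x = F x" "\<forall>e\<in>?D. G ` cell e \<subseteq> T e" by blast
      show ?thesis
      proof (cases "cell e \<subseteq> ?Bd")
        case True
        have "G ` cell e \<subseteq> T e"
        proof -
          have "G ` cell e = F ` (cell e \<inter> ?Bd)" using True G(2) by force
          then show ?thesis using psubset.prems(5)[OF e] by simp
        qed
        moreover have "?Bd \<union> \<Union> (cell ` \<D>) = ?S" using True e by auto
        moreover have "G ` cell d \<subseteq> T d" if "d \<in> \<D>" for d
          using G(3) \<open>G ` cell e \<subseteq> T e\<close> that by (cases "d = e") auto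
        ultimately show ?thesis using G(1,2) by (intro exI[of _ G]) metis
      next
        case False
        obtain z I where zI: "e = (z, I)" by fastforce
        have eg: "(z, I) \<in> grid N J" using e psubset.prems(1) zI by blast
        have meet: "?S \<inter> cell e \<subseteq> cell_bdry e"
        proof
          fix x assume x: "x \<in> ?S \<inter> cell e"
          show "x \<in> cell_bdry e"
          proof (cases "x \<in> ?Bd")
            case True
            then show ?thesis
              using cell_big_bdry[OF eg] False grid_cell_subset[OF eg] x unfolding zI by blast
          next
            case False
            then obtain d where d: "d \<in> ?D" "x \<in> cell d" using x by blast
            obtain z' I' where zI': "d = (z', I')" by fastforce
            show ?thesis
              using cells_meet_in_bdry[of I' I z z' x] fin[of d] emax[of d] d x unfolding zI zI' by auto
          qed
        qed
        have sub: "cell_bdry e \<subseteq> \<Union> (cell ` faces e)" by (rule cell_bdry_faces)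
        then have "cell_bdry e \<subseteq> ?S" using face'[OF e] by blast
        then have "continuous_on (cell_bdry e) G" using G(1) continuous_on_subset by blast
        moreover have "G \<in> cell_bdry e \<rightarrow> T e"
        proof
          fix x assume "x \<in> cell_bdry e"
          then obtain d where d: "d \<in> faces e" "x \<in> cell d" using sub by blast
          then have "G x \<in> T d" using G(3) face'[OF e] by blast
          then show "G x \<in> T e" using psubset.prems(4)[OF e d(1)] by blast
        qed
        ultimately obtain g where g: "continuous_on (cell e) g" "g \<in> cell e \<rightarrow> T e"
          "\<And>x. x \<in> cell_bdry e \<Longrightarrow> g x = G x"
          using box_connectedD[OF psubset.prems(3)[OF e] fin[OF e] order_refl]
          unfolding cell_def cell_bdry_def by metis
        define H where "H x = (if x \<in> ?S then G x else g x)" for x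
        have "closed (\<Union> (cell ` ?D))" using psubset.hyps by (auto intro: closed_cell)
        then have "continuous_on (?S \<union> cell e) H"
          unfolding H_def using closed_big_bdry[OF J, of N] G(1) g(1) meet g(3)
          by (intro continuous_on_cases closed_cell) auto
        moreover have "?Bd \<union> \<Union> (cell ` \<D>) = ?S \<union> cell e" using e by auto
        moreover have "H ` cell d \<subseteq> T d" if "d \<in> \<D>" for d
        proof (cases "d = e")
          case True
          have "H x = g x" if "x \<in> cell e" for x
            using that meet g(3) unfolding H_def by auto
          then show ?thesis using g(2) True by auto
        next
          case False
          then have "H ` cell d = G ` cell d" using that unfolding H_def by (intro image_cong) auto
          then show ?thesis using G(3) that False by auto
        qed
        ultimately show ?thesis using G(2) by (intro exI[of _ H]) (auto simp: H_def)
      qed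
    qed
  qed
qed

text \<open>
  Cells whose trace on the boundary lies over both sets are sent into the intersection as long as
  their dimension permits.
\<close>

lemma box_extension_of_cover:
  fixes f :: "(nat \<Rightarrow> real) \<Rightarrow> 'b::topological_space"
  assumes A: "box_connected (Suc n) XA" and B: "box_connected (Suc n) XB"
    and AB: "box_connected n (XA \<inter> XB)"
    and J: "finite J" "card J \<le> Suc n"
    and f: "continuous_on (box_bdry p J) f"
    and U: "open UA" "open UB" "box_bdry p J \<subseteq> UA \<union> UB"
      "f ` (box_bdry p J \<inter> UA) \<subseteq> XA" "f ` (box_bdry p J \<inter> UB) \<subseteq> XB"
  obtains g where "continuous_on (unit_box p J) g" "g \<in> unit_box p J \<rightarrow> XA \<union> XB"
    "\<And>x. x \<in> box_bdry p J \<Longrightarrow> g x = f x"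
proof -
  have Ucov: "box_bdry p J \<subseteq> \<Union>{UA, UB}" using U(3) by auto
  have Uop: "\<And>G. G \<in> {UA, UB} \<Longrightarrow> open G" using U(1,2) by auto
  obtain \<epsilon> where \<epsilon>: "0 < \<epsilon>" "\<And>x. x \<in> box_bdry p J \<Longrightarrow> \<exists>G\<in>{UA, UB}. ball x \<epsilon> \<subseteq> G"
    using Heine_Borel_lemma[OF compact_box_bdry[OF J(1)] Ucov Uop] by blast
  \<comment> \<open>\<open>\<epsilon>\<close> is a Lebesgue number of the cover. Two points of a
    rescaled cell differ by at most \<open>1 / N\<close> in each coordinate, hence have distance at
    most \<open>2 / N\<close> by \<open>dist_fun_le\<close>.\<close>
  obtain N0 :: nat where N0: "2 / \<epsilon> < real N0" using reals_Archimedean2 by blast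
  have N0pos: "0 < real N0" using N0 \<epsilon>(1) by (meson divide_pos_pos order_less_trans zero_less_numeral)
  define N where "N = N0"
  have N: "0 < N" "2 / real N < \<epsilon>"
    using N0 N0pos \<epsilon>(1) unfolding N_def by (auto simp: field_simps)
  define s where "s y = (\<lambda>i. p i + y i / real N)" for y :: "nat \<Rightarrow> real"
  define F where "F y = f (s y)" for y
  have s_bdry: "s y \<in> box_bdry p J" if "y \<in> big_bdry N J" for y
  proof -
    have "0 \<le> y i / real N" "y i / real N \<le> (if i \<in> J then 1 else 0)" for i
      using that N(1) unfolding big_bdry_def big_box_def by (auto simp: divide_le_eq split: if_splits)
    moreover have "\<exists>i\<in>J. y i / real N = 0 \<or> y i / real N = 1"
      using that N(1) unfolding big_bdry_def by force
    ultimately show ?thesis unfolding s_def box_bdry_def unit_box_def by auto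
  qed
  have cont_s: "continuous_on S s" for S
    unfolding s_def by (intro continuous_on_coordinatewise_then_product continuous_intros continuous_on_id) (use N in auto)
  have F: "continuous_on (big_bdry N J) F"
    unfolding F_def by (rule continuous_on_compose2[OF f cont_s]) (use s_bdry in auto)
  let ?tr = "\<lambda>e. F ` (cell e \<inter> big_bdry N J)"
  have dich: "?tr e \<subseteq> XA \<or> ?tr e \<subseteq> XB" for e
  proof (cases "cell e \<inter> big_bdry N J = {}")
    case False
    then obtain y0 where y0: "y0 \<in> cell e" "y0 \<in> big_bdry N J" by auto
    obtain G where G: "G \<in> {UA, UB}" "ball (s y0) \<epsilon> \<subseteq> G" using \<epsilon>(2)[OF s_bdry[OF y0(2)]] by blast
    have "s y \<in> G" if "y \<in> cell e" for y
    proof -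
      have "\<bar>s y0 i - s y i\<bar> \<le> 1 / real N" for i
      proof -
        obtain z I where zI: "e = (z, I)" by fastforce
        have "\<bar>y0 i - y i\<bar> \<le> 1"
          using y0(1) that unfolding zI cell_iff by (smt (verit))
        then have "\<bar>y0 i - y i\<bar> / real N \<le> 1 / real N" using N(1) by (simp add: divide_right_mono)
        then show ?thesis using N(1) by (simp add: s_def abs_divide flip: diff_divide_distrib)
      qed
      then have "dist (s y0) (s y) \<le> 2 * (1 / real N)" by (rule dist_fun_le)
      then have "dist (s y0) (s y) < \<epsilon>" using N(2) by simp
      then show ?thesis using G(2) by auto
    qed
    then show ?thesis using G(1) U(4,5) s_bdry unfolding F_def by (auto simp: image_subset_iff)
  qed auto
  \<comment> \<open>A low-dimensional cell over both sets may be a face of cells assigned to either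
    one, so only the intersection is a consistent target. A cell of dimension \<open>n + 1\<close>
    is a face of nothing in the grid, and there the preference for \<open>XA\<close> does no harm.
    Cells that miss the boundary count as lying over both.\<close>
  define T where "T e = (if card (snd e) \<le> n \<and> ?tr e \<subseteq> XA \<inter> XB then XA \<inter> XB
      else if ?tr e \<subseteq> XA then XA else XB)" for e
  have card_e: "card (snd e) \<le> Suc n" if "e \<in> grid N J" for e
    using that J by (auto simp: grid_def intro: order_trans[OF card_mono])
  have "\<exists>G. continuous_on (big_bdry N J \<union> \<Union> (cell ` grid N J)) G \<and> (\<forall>x\<in>big_bdry N J. G x = F x) \<and>
             (\<forall>e\<in>grid N J. G ` cell e \<subseteq> T e)"
  proof (rule cellwise_extension[OF J(1) F])
    fix e assume e: "e \<in> grid N J"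
    show "box_connected (card (snd e)) (T e)"
      using card_e[OF e] A B AB by (auto simp: T_def intro: box_connected_mono)
    show "?tr e \<subseteq> T e" using dich[of e] by (auto simp: T_def)
    fix d assume d: "d \<in> faces e"
    have "cell d \<subseteq> cell e" using d by (rule face_subset)
    then have tr: "?tr d \<subseteq> ?tr e" by blast
    have cd: "card (snd d) \<le> n"
      using card_faces[OF grid_finite_snd[OF J(1) e] d] card_e[OF e] by simp
    show "T d \<subseteq> T e"
    proof (cases "?tr d \<subseteq> XA \<inter> XB")
      case True
      then have "T d = XA \<inter> XB" using cd unfolding T_def by simp
      then show ?thesis unfolding T_def by simp
    next
      case False
      then have nd: "T d = (if ?tr d \<subseteq> XA then XA else XB)" unfolding T_def by simp
      have "\<not> ?tr e \<subseteq> XA \<inter> XB" using False tr by (meson order_trans)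
      then have ne: "T e = (if ?tr e \<subseteq> XA then XA else XB)" unfolding T_def by simp
      show ?thesis
      proof (cases "?tr e \<subseteq> XA")
        case True
        then have "?tr d \<subseteq> XA" using tr by (meson order_trans)
        then show ?thesis using True nd ne by simp
      next
        case eA: False
        then have "?tr d \<subseteq> XB" using dich[of e] tr by (meson order_trans)
        then have "\<not> ?tr d \<subseteq> XA" using False by simp
        then show ?thesis using eA nd ne by simp
      qed
    qed
  qed (use grid_faces in auto)
  then obtain G where G: "continuous_on (big_bdry N J \<union> \<Union> (cell ` grid N J)) G"
    "\<And>x. x \<in> big_bdry N J \<Longrightarrow> G x = F x" "\<And>e. e \<in> grid N J \<Longrightarrow> G ` cell e \<subseteq> T e" by blast
  define r where "r x = (\<lambda>i. real N * (x i - p i))" for x :: "nat \<Rightarrow> real"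
  have r_box: "r x \<in> big_box N J" if "x \<in> unit_box p J" for x
  proof -
    have *: "0 \<le> x i - p i" "x i - p i \<le> (if i \<in> J then 1 else 0)" for i
      using that unfolding unit_box_def by (auto simp: algebra_simps)
    have "0 \<le> real N * (x i - p i)" "real N * (x i - p i) \<le> (if i \<in> J then real N else 0)" for i
      using *(1)[of i] mult_left_mono[OF *(2)[of i], of "real N"] by (cases "i \<in> J"; simp)+
    then show ?thesis unfolding r_def big_box_def by blast
  qed
  have r_bdry: "r x \<in> big_bdry N J" if xb: "x \<in> box_bdry p J" for x
  proof -
    obtain i where i: "i \<in> J" "x i = p i \<or> x i = p i + 1" and x: "x \<in> unit_box p J"
      using xb unfolding box_bdry_def by blast
    then have "r x i = 0 \<or> r x i = real N" by (auto simp: r_def)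
    then show ?thesis using i(1) r_box[OF x] unfolding big_bdry_def by blast
  qed
  have sr: "s (r x) = x" for x using N(1) by (auto simp: s_def r_def)
  have cont_r: "continuous_on S r" for S
    unfolding r_def by (intro continuous_on_coordinatewise_then_product continuous_intros continuous_on_id)
  have cov: "big_box N J \<subseteq> \<Union> (cell ` grid N J)" by (rule big_box_cover[OF N(1)])
  have GX: "G y \<in> XA \<union> XB" if y: "y \<in> big_box N J" for y
  proof -
    from y cov obtain e where e: "e \<in> grid N J" "y \<in> cell e" by blast
    then have "G y \<in> T e" using G(3) by blast
    then show ?thesis by (auto simp: T_def split: if_splits)
  qed
  show ?thesis
  proof (rule that[of "G \<circ> r"])
    show "continuous_on (unit_box p J) (G \<circ> r)"
      unfolding comp_def by (rule continuous_on_compose2[OF G(1) cont_r]) (use r_box cov in blast)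
    show "G \<circ> r \<in> unit_box p J \<rightarrow> XA \<union> XB" using GX r_box by auto
    show "(G \<circ> r) x = f x" if "x \<in> box_bdry p J" for x
      using G(2)[OF r_bdry[OF that]] sr by (simp add: F_def)
  qed
qed

section \<open>Gluing simplicial complexes\<close>

definition realization :: "'a set set \<Rightarrow> ('a \<Rightarrow> real) set" where
  "realization K = {x. (\<forall>v. 0 \<le> x v) \<and> {v. x v \<noteq> 0} \<in> K \<and> (\<Sum>v | x v \<noteq> 0. x v) = 1}"

lemma geometric_realization_eq: "geometric_realization K = top_of_set (realization K)"
  by (simp add: geometric_realization_def realization_def euclidean_product_topology)

lemma realization_Un: "realization (A \<union> B) = realization A \<union> realization B"
  and realization_Int: "realization (A \<inter> B) = realization A \<inter> realization B"
  by (auto simp: realization_def)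

definition complex_on :: "'a set \<Rightarrow> 'a set set \<Rightarrow> bool" where
  "complex_on V K \<longleftrightarrow> finite V \<and> K \<subseteq> Pow V \<and> (\<forall>\<sigma>\<in>K. \<forall>\<tau>\<subseteq>\<sigma>. \<tau> \<in> K)"

lemma complex_onD: "complex_on V K \<Longrightarrow> \<sigma> \<in> K \<Longrightarrow> \<tau> \<subseteq> \<sigma> \<Longrightarrow> \<tau> \<in> K"
  by (auto simp: complex_on_def)

lemma complex_on_Un: "complex_on V A \<Longrightarrow> complex_on V B \<Longrightarrow> complex_on V (A \<union> B)"
  by (auto simp: complex_on_def)

lemma sum_support:
  fixes x :: "'a \<Rightarrow> real"
  assumes "finite V" "{v. x v \<noteq> 0} \<subseteq> V"
  shows "(\<Sum>v | x v \<noteq> 0. x v) = sum x V"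
  using assms by (intro sum.mono_neutral_left) auto

text \<open>The support moves with \<open>x\<close>, but the fixed finite set \<open>V\<close> turns
  the condition on the sum into a linear one; this makes straight segments and renormalisation
  computable.\<close>

lemma realization_iff:
  assumes "complex_on V K"
  shows "x \<in> realization K \<longleftrightarrow> (\<forall>v. 0 \<le> x v) \<and> {v. x v \<noteq> 0} \<in> K \<and> sum x V = 1"
proof -
  have "(\<Sum>v | x v \<noteq> 0. x v) = sum x V" if "{v. x v \<noteq> 0} \<in> K"
    using that assms by (intro sum_support) (auto simp: complex_on_def)
  then show ?thesis unfolding realization_def by auto
qed

lemma realization_segment:
  assumes K: "complex_on V K" and xy: "x \<in> realization K" "y \<in> realization K"
    and t: "0 \<le> t" "t \<le> 1" and su: "{v. x v \<noteq> 0} \<union> {v. y v \<noteq> 0} \<in> K"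
  shows "(\<lambda>v. (1 - t) * x v + t * y v) \<in> realization K"
proof -
  have "{v. (1 - t) * x v + t * y v \<noteq> 0} \<subseteq> {v. x v \<noteq> 0} \<union> {v. y v \<noteq> 0}" by auto
  then have "{v. (1 - t) * x v + t * y v \<noteq> 0} \<in> K" using complex_onD[OF K su] by blast
  moreover have "(\<Sum>v\<in>V. (1 - t) * x v + t * y v) = (1 - t) * sum x V + t * sum y V"
    by (simp add: sum.distrib sum_distrib_left)
  ultimately show ?thesis using xy t unfolding realization_iff[OF K] by auto
qed

text \<open>If \<open>\<phi> x\<close> and \<open>f x\<close> lie in a common simplex for every
  boundary point \<open>x\<close>, the segments between them form a homotopy inside the complex. An
  extension of the boundary values of \<open>\<phi>\<close> can then be traded for one of
  \<open>f\<close>.\<close>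

lemma box_extension_homotopic:
  assumes K: "complex_on V K" and J: "finite J"
    and f: "continuous_on (box_bdry p J) f" "f \<in> box_bdry p J \<rightarrow> realization K"
    and \<phi>: "continuous_on (unit_box p J) \<phi>" "\<phi> \<in> unit_box p J \<rightarrow> realization K"
    and su: "\<And>x. x \<in> box_bdry p J \<Longrightarrow> {v. \<phi> x v \<noteq> 0} \<union> {v. f x v \<noteq> 0} \<in> K"
  obtains g where "continuous_on (unit_box p J) g" "g \<in> unit_box p J \<rightarrow> realization K"
    "\<And>x. x \<in> box_bdry p J \<Longrightarrow> g x = f x"
proof -
  define h where "h q = (\<lambda>v. (1 - fst q) * \<phi> (snd q) v + fst q * f (snd q) v)" for q
  have "continuous_on ({0..1} \<times> box_bdry p J) h"
  proof -
    have 1: "continuous_on ({0..1} \<times> box_bdry p J) (\<lambda>x. \<phi> (snd x))"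
      by (rule continuous_on_compose2[OF \<phi>(1) continuous_on_snd[OF continuous_on_id]]) (use box_bdry_subset in auto)
    have 2: "continuous_on ({0..1} \<times> box_bdry p J) (\<lambda>x. f (snd x))"
      by (rule continuous_on_compose2[OF f(1) continuous_on_snd[OF continuous_on_id]]) auto
    show ?thesis
      unfolding h_def
      by (intro continuous_on_coordinatewise_then_product continuous_on_add continuous_on_mult
          continuous_on_diff continuous_on_const continuous_on_fst continuous_on_id
          continuous_on_coord'[OF 1] continuous_on_coord'[OF 2])
  qed
  moreover have "h \<in> {0..1} \<times> box_bdry p J \<rightarrow> realization K"
  proof
    fix q :: "real \<times> (nat \<Rightarrow> real)" assume "q \<in> {0..1} \<times> box_bdry p J"
    then obtain t x where q: "q = (t, x)" "0 \<le> t" "t \<le> 1" "x \<in> box_bdry p J" by auto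
    then have "\<phi> x \<in> realization K" "f x \<in> realization K"
      using f(2) \<phi>(2) box_bdry_subset[of p J] by blast+
    then show "h q \<in> realization K"
      using realization_segment[OF K _ _ q(2,3) su[OF q(4)]] unfolding h_def q(1) by simp
  qed
  moreover have "h (0, x) = \<phi> x" for x by (simp add: h_def)
  ultimately obtain g where "continuous_on (unit_box p J) g" "g \<in> unit_box p J \<rightarrow> realization K"
    "\<And>x. x \<in> box_bdry p J \<Longrightarrow> g x = h (1, x)"
    using box_homotopy_extension[OF J \<phi>] by metis
  then show ?thesis using that by (simp add: h_def)
qed

text \<open>Every simplex can be enlarged by the apex \<open>u\<close>, so each boundary map is
  joined by straight segments to the constant map at \<open>u\<close>, which certainly
  extends.\<close>

lemma box_connected_cone:
  assumes K: "complex_on V K" and ne: "K \<noteq> {}" and cone: "\<And>\<sigma>. \<sigma> \<in> K \<Longrightarrow> insert u \<sigma> \<in> K"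
  shows "box_connected k (realization K)"
  unfolding box_connected_def
proof (intro allI impI, elim conjE)
  fix p J and f :: "(nat \<Rightarrow> real) \<Rightarrow> 'a \<Rightarrow> real"
  assume J: "finite J" and f: "continuous_on (box_bdry p J) f" "f \<in> box_bdry p J \<rightarrow> realization K"
  define \<delta> :: "'a \<Rightarrow> real" where "\<delta> v = (if v = u then 1 else 0)" for v
  have supp: "{v. \<delta> v \<noteq> 0} = {u}" by (auto simp: \<delta>_def)
  obtain \<sigma> where "\<sigma> \<in> K" using ne by auto
  then have "{u} \<in> K" using complex_onD[OF K cone] by blast
  then have "\<delta> \<in> realization K" by (simp add: realization_def supp) (simp add: \<delta>_def)
  moreover have "{v. \<delta> v \<noteq> 0} \<union> {v. f x v \<noteq> 0} \<in> K" if "x \<in> box_bdry p J" for x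
  proof -
    have "{v. f x v \<noteq> 0} \<in> K" using that f(2) by (auto simp: realization_def)
    then show ?thesis using cone supp by auto
  qed
  ultimately obtain g where "continuous_on (unit_box p J) g" "g \<in> unit_box p J \<rightarrow> realization K"
    "\<And>x. x \<in> box_bdry p J \<Longrightarrow> g x = f x"
    using box_extension_homotopic[OF K J f, of "\<lambda>_. \<delta>"] by auto
  then show "\<exists>g. continuous_on (unit_box p J) g \<and> g \<in> unit_box p J \<rightarrow> realization K \<and> (\<forall>x\<in>box_bdry p J. g x = f x)"
    by blast
qed

text \<open>The complement is a finite union of closed sets, one for each non-face
  \<open>\<tau>\<close> all of whose coordinates are at least \<open>\<epsilon>\<close>. The
  non-strict inequality is what makes these sets closed.\<close>

lemma open_superlevel_in_complex:
  assumes A: "complex_on V A"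
  shows "open {x :: 'a \<Rightarrow> real. {v \<in> V. \<epsilon> \<le> x v} \<in> A}"
proof -
  have "{x :: 'a \<Rightarrow> real. {v \<in> V. \<epsilon> \<le> x v} \<in> A} = - (\<Union>\<tau>\<in>Pow V - A. \<Inter>v\<in>\<tau>. {x. \<epsilon> \<le> x v})"
    (is "?L = - ?R")
  proof (intro equalityI subsetI)
    fix x assume x: "x \<in> ?L"
    show "x \<in> - ?R"
    proof
      assume "x \<in> ?R"
      then obtain \<tau> where "\<tau> \<subseteq> V" "\<tau> \<notin> A" "\<forall>v\<in>\<tau>. \<epsilon> \<le> x v" by auto
      then have "\<tau> \<subseteq> {v \<in> V. \<epsilon> \<le> x v}" by auto
      then show False using x \<open>\<tau> \<notin> A\<close> complex_onD[OF A] by blast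
    qed
  next
    fix x assume x: "x \<in> - ?R"
    show "x \<in> ?L"
    proof (rule ccontr)
      assume "x \<notin> ?L"
      then have "{v \<in> V. \<epsilon> \<le> x v} \<in> Pow V - A" by simp
      moreover have "x \<in> (\<Inter>v\<in>{v \<in> V. \<epsilon> \<le> x v}. {x. \<epsilon> \<le> x v})" by simp
      ultimately have "x \<in> ?R" by (rule UN_I)
      with x show False by (meson ComplD)
    qed
  qed
  moreover have "closed ?R"
  proof (intro closed_UN ballI closed_INT)
    show "finite (Pow V - A)" using A by (simp add: complex_on_def)
    show "closed {x :: 'a \<Rightarrow> real. \<epsilon> \<le> x v}" for v
      by (rule closed_Collect_le[OF continuous_on_const continuous_on_coord])
  qed
  ultimately show ?thesis by (simp only: open_Compl)
qed

text \<open>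
  Truncating the barycentric coordinates at a small height and renormalising is homotopic to the
  identity and maps a neighbourhood of each subcomplex into that subcomplex.
\<close>

lemma box_connected_Un:
  assumes A: "complex_on V A" and B: "complex_on V B"
    and cA: "box_connected (Suc n) (realization A)" and cB: "box_connected (Suc n) (realization B)"
    and cAB: "box_connected n (realization (A \<inter> B))"
  shows "box_connected (Suc n) (realization (A \<union> B))"
  unfolding box_connected_def
proof (intro allI impI, elim conjE)
  let ?K = "A \<union> B"
  fix p J and f :: "(nat \<Rightarrow> real) \<Rightarrow> 'a \<Rightarrow> real"
  assume J: "finite J" "card J \<le> Suc n"
    and f: "continuous_on (box_bdry p J) f" "f \<in> box_bdry p J \<rightarrow> realization ?K"
  have K: "complex_on V ?K" using A B by (rule complex_on_Un)
  have V: "finite V" using A by (simp add: complex_on_def)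
  \<comment> \<open>With this height \<open>card V * \<epsilon> < 1\<close>, so some coordinate of
    each point exceeds \<open>\<epsilon>\<close> and the renormalising sum is positive.\<close>
  define \<epsilon> where "\<epsilon> = 1 / (real (card V) + 1)"
  have \<epsilon>: "0 < \<epsilon>" by (auto simp: \<epsilon>_def)
  define w where "w x v = max (x v - \<epsilon>) 0" for x :: "'a \<Rightarrow> real" and v
  define \<psi> where "\<psi> x = (\<lambda>v. w x v / sum (w x) V)" for x
  have w0: "0 \<le> w x v" for x v by (simp add: w_def)
  have wpos: "0 < sum (w x) V" if x: "x \<in> realization ?K" for x
  proof (rule ccontr)
    assume "\<not> ?thesis"
    then have "sum (w x) V = 0" using w0 by (meson not_less order_antisym sum_nonneg)
    then have "x v \<le> \<epsilon>" if "v \<in> V" for v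
      using that V w0 sum_nonneg_eq_0_iff[of V "w x"] by (auto simp: w_def max_def split: if_splits)
    then have "sum x V \<le> card V * \<epsilon>" using sum_bounded_above by blast
    also have "\<dots> < 1" by (simp add: \<epsilon>_def)
    finally show False using x by (simp add: realization_iff[OF K])
  qed
  have supp\<psi>: "{v. \<psi> x v \<noteq> 0} = {v. \<epsilon> < x v}" if "x \<in> realization ?K" for x
    using wpos[OF that] by (auto simp: \<psi>_def w_def max_def)
  have sum\<psi>: "sum (\<psi> x) V = 1" if "x \<in> realization ?K" for x
    using wpos[OF that] by (simp add: \<psi>_def flip: sum_divide_distrib)
  have \<psi>0: "0 \<le> \<psi> x v" for x v
    using w0 by (simp add: \<psi>_def sum_nonneg)
  \<comment> \<open>The strict superlevel set is the support of \<open>\<psi> x\<close>. The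
    non-strict one, which gives open conditions, lies between it and the support of
    \<open>x\<close>.\<close>
  have sub: "{v. \<epsilon> < x v} \<subseteq> {v \<in> V. \<epsilon> \<le> x v}" "{v \<in> V. \<epsilon> \<le> x v} \<subseteq> {v. x v \<noteq> 0}"
    if "x \<in> realization ?K" for x
    using \<epsilon> that K unfolding realization_def complex_on_def by force+
  let ?U = "\<lambda>C. {x :: 'a \<Rightarrow> real. {v \<in> V. \<epsilon> \<le> x v} \<in> C}"
  have \<psi>_in: "\<psi> x \<in> realization C" if "complex_on V C" "x \<in> realization ?K" "x \<in> ?U C" for x C
  proof -
    have "{v. \<psi> x v \<noteq> 0} \<in> C"
      using that supp\<psi> sub complex_onD[OF that(1)] by (metis (no_types, lifting) mem_Collect_eq)
    then show ?thesis using that \<psi>0 sum\<psi> by (simp add: realization_iff[OF that(1)])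
  qed
  have cont\<psi>: "continuous_on (realization ?K) \<psi>"
    unfolding \<psi>_def w_def
    by (intro continuous_on_coordinatewise_then_product continuous_intros continuous_on_id)
      (use wpos in \<open>force simp: w_def\<close>)
  have "\<exists>O'. open O' \<and> O' \<inter> box_bdry p J = f -` ?U C \<inter> box_bdry p J" if "complex_on V C" for C
    using f(1) open_superlevel_in_complex[OF that] unfolding continuous_on_open_invariant by blast
  then obtain OA OB where O: "open OA" "OA \<inter> box_bdry p J = f -` ?U A \<inter> box_bdry p J"
    "open OB" "OB \<inter> box_bdry p J = f -` ?U B \<inter> box_bdry p J"
    using A B by meson
  have fK: "f x \<in> realization ?K" if "x \<in> box_bdry p J" for x using that f(2) by auto
  have cov: "box_bdry p J \<subseteq> OA \<union> OB"
  proof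
    fix x assume x: "x \<in> box_bdry p J"
    have "{v. f x v \<noteq> 0} \<in> ?K" using fK[OF x] by (simp add: realization_def)
    then have "{v \<in> V. \<epsilon> \<le> f x v} \<in> ?K" using complex_onD[OF K] sub(2)[OF fK[OF x]] by blast
    then show "x \<in> OA \<union> OB" using x O(2,4) by blast
  qed
  have cAB': "box_connected n (realization A \<inter> realization B)" using cAB by (simp add: realization_Int)
  \<comment> \<open>\<open>f\<close> itself need not map \<open>OA\<close> and \<open>OB\<close>
    into the two subcomplexes, but its truncation does. Since \<open>\<psi>\<close> only shrinks
    supports, \<open>box_extension_homotopic\<close> leads back to \<open>f\<close> at the
    end.\<close>
  have c\<psi>f: "continuous_on (box_bdry p J) (\<lambda>x. \<psi> (f x))"
    by (rule continuous_on_compose2[OF cont\<psi> f(1)]) (use fK in auto)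
  have imA: "(\<lambda>x. \<psi> (f x)) ` (box_bdry p J \<inter> OA) \<subseteq> realization A"
    using \<psi>_in[OF A] fK O(2) by blast
  have imB: "(\<lambda>x. \<psi> (f x)) ` (box_bdry p J \<inter> OB) \<subseteq> realization B"
    using \<psi>_in[OF B] fK O(4) by blast
  obtain \<phi> where \<phi>: "continuous_on (unit_box p J) \<phi>"
    "\<phi> \<in> unit_box p J \<rightarrow> realization A \<union> realization B"
    "\<And>x. x \<in> box_bdry p J \<Longrightarrow> \<phi> x = \<psi> (f x)"
    using box_extension_of_cover[OF cA cB cAB' J c\<psi>f O(1,3) cov imA imB] by blast
  have "{v. \<phi> x v \<noteq> 0} \<union> {v. f x v \<noteq> 0} \<in> ?K" if x: "x \<in> box_bdry p J" for x
  proof -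
    have "{v. \<phi> x v \<noteq> 0} \<subseteq> {v. f x v \<noteq> 0}"
      using supp\<psi>[OF fK[OF x]] \<phi>(3)[OF x] sub[OF fK[OF x]] by auto
    then show ?thesis using fK[OF x] by (simp add: Un_absorb1 realization_def)
  qed
  then obtain g where "continuous_on (unit_box p J) g" "g \<in> unit_box p J \<rightarrow> realization ?K"
    "\<And>x. x \<in> box_bdry p J \<Longrightarrow> g x = f x"
    using box_extension_homotopic[OF K J(1) f \<phi>(1)] \<phi>(2) by (auto simp: realization_Un)
  then show "\<exists>g. continuous_on (unit_box p J) g \<and> g \<in> unit_box p J \<rightarrow> realization ?K \<and> (\<forall>x\<in>box_bdry p J. g x = f x)"
    by blast
qed

section \<open>Unions of simplices with many common points\<close>

lemma box_connected_simplex: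
  assumes "finite S" "S \<noteq> {}"
  shows "box_connected k (realization (Pow S))"
proof -
  obtain u where "u \<in> S" using assms by blast
  then show ?thesis
    using assms(1) by (intro box_connected_cone[of S "Pow S" u]) (auto simp: complex_on_def)
qed

lemma complex_on_UN_Pow:
  assumes "finite W" "\<And>w. w \<in> W \<Longrightarrow> S w \<subseteq> V" "finite V"
  shows "complex_on V (\<Union>w\<in>W. Pow (S w))"
  using assms by (fastforce simp: complex_on_def)

lemma box_connected_nonempty:
  assumes "box_connected k X"
  shows "X \<noteq> {}"
proof -
  let ?p = "\<lambda>_::nat. 0::real"
  have b: "box_bdry ?p {} = {}" by (simp add: box_bdry_def)
  obtain g where g: "g \<in> unit_box ?p {} \<rightarrow> X"
    by (rule box_connectedD[OF assms, of "{}" ?p "\<lambda>_. undefined"]) (simp_all add: b)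
  have "?p \<in> unit_box ?p {}" by (simp add: unit_box_def)
  then have "g ?p \<in> X" using g by blast
  then show ?thesis by blast
qed

lemma box_connected_0: "realization K \<noteq> {} \<Longrightarrow> box_connected 0 (realization K)"
proof -
  assume "realization K \<noteq> {}"
  then obtain x where x: "x \<in> realization K" by auto
  show ?thesis
    unfolding box_connected_def
  proof (intro allI impI, elim conjE)
    fix p :: "nat \<Rightarrow> real" and J :: "nat set" and f :: "(nat \<Rightarrow> real) \<Rightarrow> 'a \<Rightarrow> real"
    assume "finite J" "card J \<le> 0"
    then have "box_bdry p J = {}" by (simp add: box_bdry_def)
    then show "\<exists>g. continuous_on (unit_box p J) g \<and> g \<in> unit_box p J \<rightarrow> realization K \<and> (\<forall>x\<in>box_bdry p J. g x = f x)"
      using x by (intro exI[of _ "\<lambda>_. x"]) auto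
  qed
qed

lemma realization_simplex_nonempty:
  assumes "v \<in> S"
  shows "realization (Pow S) \<noteq> {}"
proof -
  have "(\<lambda>u. if u = v then 1 else 0) \<in> realization (Pow S)"
    using assms by (auto simp: realization_def)
  then show ?thesis by blast
qed

text \<open>A form of the nerve lemma. The last simplex meets the union of the others in the
  simplices on \<open>S v \<inter> S w\<close>. Adding \<open>w\<close> to a set \<open>T\<close> of
  indices costs one element, so these satisfy the hypothesis with \<open>k\<close> lowered by one,
  which is just what \<open>box_connected_Un\<close> asks of an intersection.\<close>

lemma box_connected_UN_simplices:
  assumes "finite W" "W \<noteq> {}" "\<And>w. w \<in> W \<Longrightarrow> finite (S w)"
    and "\<And>T. T \<subseteq> W \<Longrightarrow> T \<noteq> {} \<Longrightarrow> card T \<le> Suc k \<Longrightarrow> (\<Inter>w\<in>T. S w) \<noteq> {}"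
  shows "box_connected k (realization (\<Union>w\<in>W. Pow (S w)))"
  using assms
proof (induction W arbitrary: S k rule: finite_ne_induct)
  case (singleton w)
  then have "S w \<noteq> {}" using singleton(2)[of "{w}"] by auto
  then show ?case using singleton(1) box_connected_simplex[of "S w" k] by simp
next
  case (insert w W)
  have Sne: "S v \<noteq> {}" if "v \<in> insert w W" for v
    using insert.prems(2)[of "{v}"] that by auto
  show ?case
  proof (cases k)
    case 0
    obtain v where "v \<in> S w" using Sne by blast
    then have "realization (Pow (S w)) \<noteq> {}" by (rule realization_simplex_nonempty)
    then show ?thesis unfolding 0 by (intro box_connected_0) (auto simp: realization_Un)
  next
    case (Suc n)
    define V where "V = (\<Union>v\<in>insert w W. S v)"
    have V: "finite V" using insert by (auto simp: V_def)
    let ?A = "\<Union>v\<in>W. Pow (S v)"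
    have "box_connected (Suc n) (realization (?A \<union> Pow (S w)))"
    proof (rule box_connected_Un)
      show "complex_on V ?A" using insert V by (intro complex_on_UN_Pow) (auto simp: V_def)
      show "complex_on V (Pow (S w))" using V by (auto simp: V_def complex_on_def)
      show "box_connected (Suc n) (realization ?A)"
      proof (rule insert.IH)
        fix T assume T: "T \<subseteq> W" "T \<noteq> {}" "card T \<le> Suc (Suc n)"
        then show "\<Inter> (S ` T) \<noteq> {}" using insert.prems(2)[of T] Suc by blast
      qed (use insert.prems in auto)
      show "box_connected (Suc n) (realization (Pow (S w)))"
        using insert.prems(1) Sne by (intro box_connected_simplex) auto
      have "?A \<inter> Pow (S w) = (\<Union>v\<in>W. Pow (S v \<inter> S w))" by auto
      moreover have "box_connected n (realization (\<Union>v\<in>W. Pow (S v \<inter> S w)))"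
      proof (rule insert.IH)
        fix T assume T: "T \<subseteq> W" "T \<noteq> {}" "card T \<le> Suc n"
        then have "card (insert w T) \<le> Suc k"
          using Suc finite_subset[OF T(1) insert.hyps(1)] by (simp add: card_insert_if)
        then have "\<Inter> (S ` insert w T) \<noteq> {}" using T insert.prems(2)[of "insert w T"] by blast
        then show "(\<Inter>v\<in>T. S v \<inter> S w) \<noteq> {}" using T(2) by auto
      qed (use insert.prems in auto)
      ultimately show "box_connected n (realization (?A \<inter> Pow (S w)))" by simp
    qed
    then show ?thesis using Suc by (simp add: Un_commute)
  qed
qed

section \<open>From cubes to spheres and disks\<close>

lemma nsphere_eq: "nsphere m = top_of_set {x. (\<Sum>i<m+1. x i ^ 2) = 1 \<and> (\<forall>i\<ge>m+1. x i = 0)}"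
proof -
  have "{x. (\<Sum>i\<le>m. x i ^ 2) = 1 \<and> (\<forall>i>m. x i = 0)} = {x. (\<Sum>i<m+1. x i ^ 2) = (1::real) \<and> (\<forall>i\<ge>m+1. x i = 0)}"
    by (auto simp: lessThan_Suc_atMost Suc_le_eq)
  then show ?thesis by (simp only: nsphere euclidean_product_topology)
qed

lemma disk_eq: "disk d = top_of_set {x. (\<Sum>i<d. x i ^ 2) \<le> 1 \<and> (\<forall>i\<ge>d. x i = 0)}"
  unfolding disk_def Euclidean_space_def
  by (simp add: subtopology_subtopology euclidean_product_topology Collect_conj_eq Int_commute)

text \<open>
  A cube inside the disk is filled with the extension from the boundary of the cube; on the rest of
  the disk the map is constant along radii.
\<close>

lemma n_connected_realization:
  assumes X: "box_connected (n + 1) (realization K)"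
  shows "n_connected_space n (geometric_realization K)"
  unfolding n_connected_space_def geometric_realization_eq
proof (intro conjI allI impI)
  have "realization K \<noteq> {}" using X by (rule box_connected_nonempty)
  then show "topspace (top_of_set (realization K)) \<noteq> {}" by auto
next
  fix m f
  assume m: "m \<le> n" and "continuous_map (nsphere m) (top_of_set (realization K)) f"
  define d where "d = m + 1"
  define Sph where "Sph = {x. (\<Sum>i<d. x i ^ 2) = (1::real) \<and> (\<forall>i\<ge>d. x i = 0)}"
  define Dsk where "Dsk = {x. (\<Sum>i<d. x i ^ 2) \<le> (1::real) \<and> (\<forall>i\<ge>d. x i = 0)}"
  have f: "continuous_on Sph f" "f \<in> Sph \<rightarrow> realization K"
    using \<open>continuous_map _ _ f\<close> unfolding nsphere_eq Sph_def d_def by auto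
  \<comment> \<open>Half the side of the inner cube. As \<open>d * a^2 = 1 / d\<close>, the cube
    lies in the disk and its interior misses the sphere.\<close>
  define a where "a = 1 / real d"
  have d: "0 < d" by (simp add: d_def)
  have a: "0 < a" "real d * a\<^sup>2 \<le> 1" using d by (auto simp: a_def power2_eq_square)
  define r where "r x = sqrt (\<Sum>i<d. x i ^ 2)" for x :: "nat \<Rightarrow> real"
  define nz where "nz x = (\<lambda>i. x i / r x)" for x
  have cont_r: "continuous_on S r" for S
    unfolding r_def by (intro continuous_on_real_sqrt continuous_on_sum continuous_on_power continuous_on_coord)
  have r_pos: "0 < r x" if "i < d" "x i \<noteq> 0" for x i
  proof -
    have "0 < x i ^ 2" using that by simp
    also have "\<dots> \<le> (\<Sum>i<d. x i ^ 2)" using that by (intro member_le_sum) auto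
    finally show ?thesis by (simp add: r_def)
  qed
  have cont_nz: "continuous_on S nz" if "\<And>x. x \<in> S \<Longrightarrow> \<exists>i<d. x i \<noteq> 0" for S
    unfolding nz_def
  proof (intro continuous_on_coordinatewise_then_product continuous_on_divide continuous_on_coord cont_r ballI)
    fix x assume "x \<in> S"
    then show "r x \<noteq> 0" using that r_pos[of _ x] by fastforce
  qed
  have nz_Sph: "nz x \<in> Sph" if "\<exists>i<d. x i \<noteq> 0" "\<And>i. d \<le> i \<Longrightarrow> x i = 0" for x
  proof -
    have "0 < r x" using that(1) r_pos by blast
    then have "(\<Sum>i<d. (x i / r x) ^ 2) = 1"
      unfolding power_divide sum_divide_distrib[symmetric]
      by (simp add: r_def sum_nonneg)
    then show ?thesis using that(2) by (simp add: Sph_def nz_def)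
  qed
  have nz_scale: "nz (\<lambda>i. x i / c) = nz x" if "0 < c" for x c
  proof -
    have "r (\<lambda>i. x i / c) = r x / c"
      using that by (simp add: r_def power_divide real_sqrt_divide flip: sum_divide_distrib)
    then show ?thesis using that by (simp add: nz_def)
  qed
  let ?J = "{..<d}" let ?p = "\<lambda>_::nat. 0::real"
  \<comment> \<open>\<open>cc\<close> carries the cube with half side \<open>a\<close> affinely onto
    the unit box, and \<open>sh\<close> recentres the unit box. On the disk \<open>sh (cc x)\<close>
    is \<open>x\<close> divided by \<open>2 * a\<close>, which has the same direction as
    \<open>x\<close>; hence the two formulas for \<open>g\<close> agree on the boundary of the
    cube.\<close>
  define sh where "sh y = (\<lambda>i. if i < d then y i - 1/2 else 0)" for y :: "nat \<Rightarrow> real"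
  define cc where "cc x = (\<lambda>i. if i < d then 1/2 + x i / (2 * a) else 0)" for x :: "nat \<Rightarrow> real"
  have sh_bdry: "\<exists>i<d. sh y i \<noteq> 0" "\<And>i. d \<le> i \<Longrightarrow> sh y i = 0" if y: "y \<in> box_bdry ?p ?J" for y
  proof -
    obtain i where i: "i < d" "y i = 0 \<or> y i = 0 + 1" using y unfolding box_bdry_def by blast
    then have "sh y i \<noteq> 0" by (auto simp: sh_def)
    then show "\<exists>i<d. sh y i \<noteq> 0" using i(1) by blast
    show "d \<le> i \<Longrightarrow> sh y i = 0" for i by (simp add: sh_def)
  qed
  have cont_sh: "continuous_on S sh" for S
    unfolding sh_def
  proof (intro continuous_on_coordinatewise_then_product)
    show "continuous_on S (\<lambda>x. if i < d then x i - 1/2 else 0)" for i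
      by (cases "i < d") (auto intro!: continuous_on_diff continuous_on_coord continuous_on_const)
  qed
  have cont_cc: "continuous_on S cc" for S
    unfolding cc_def
  proof (intro continuous_on_coordinatewise_then_product)
    show "continuous_on S (\<lambda>x. if i < d then 1/2 + x i / (2 * a) else 0)" for i
      using a(1) by (cases "i < d") (auto intro!: continuous_on_add continuous_on_divide continuous_on_coord continuous_on_const)
  qed
  obtain G where G: "continuous_on (unit_box ?p ?J) G" "G \<in> unit_box ?p ?J \<rightarrow> realization K"
    "\<And>y. y \<in> box_bdry ?p ?J \<Longrightarrow> G y = f (nz (sh y))"
  proof (rule box_connectedD[OF X, of ?J ?p "\<lambda>y. f (nz (sh y))"])
    show "card ?J \<le> n + 1" using m by (simp add: d_def)
    show "continuous_on (box_bdry ?p ?J) (\<lambda>y. f (nz (sh y)))"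
    proof (rule continuous_on_compose2[OF f(1)])
      show "continuous_on (box_bdry ?p ?J) (\<lambda>y. nz (sh y))"
      proof (rule continuous_on_compose2[OF _ cont_sh])
        show "continuous_on (sh ` box_bdry ?p ?J) nz" using sh_bdry by (intro cont_nz) blast
      qed simp
      show "(\<lambda>y. nz (sh y)) ` box_bdry ?p ?J \<subseteq> Sph" using nz_Sph sh_bdry by blast
    qed
    show "(\<lambda>y. f (nz (sh y))) \<in> box_bdry ?p ?J \<rightarrow> realization K" using nz_Sph sh_bdry f(2) by blast
  qed auto
  have cc_box: "cc x \<in> unit_box ?p ?J" if "\<forall>i<d. \<bar>x i\<bar> \<le> a" for x
  proof -
    have "0 \<le> cc x i \<and> cc x i \<le> 0 + (if i \<in> ?J then 1 else 0)" for i
    proof (cases "i < d")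
      case True
      then have "- a \<le> x i" "x i \<le> a" using that by (auto simp: abs_le_iff)
      then have "- (1/2) \<le> x i / (2 * a)" "x i / (2 * a) \<le> 1/2" using a(1) by (auto simp: field_simps)
      moreover have "cc x i = 1/2 + x i / (2 * a)" using True by (simp add: cc_def)
      ultimately have "0 \<le> cc x i" "cc x i \<le> 1" by linarith+
      then show ?thesis using True by simp
    qed (simp add: cc_def)
    then show ?thesis by (simp add: unit_box_def)
  qed
  have cc_bdry: "cc x \<in> box_bdry ?p ?J" if x: "\<forall>i<d. \<bar>x i\<bar> \<le> a" "\<exists>i<d. a \<le> \<bar>x i\<bar>" for x
  proof -
    from x obtain i where i: "i < d" "\<bar>x i\<bar> = a" by (meson order_antisym)
    then have "x i = a \<or> x i = - a" by auto
    then have "cc x i = 0 \<or> cc x i = 1" using a(1) i(1) by (auto simp: cc_def)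
    then show ?thesis using cc_box[OF x(1)] i(1) by (auto simp: box_bdry_def)
  qed
  have overlap: "G (cc x) = f (nz x)" if x: "x \<in> Dsk" "\<forall>i<d. \<bar>x i\<bar> \<le> a" "\<exists>i<d. a \<le> \<bar>x i\<bar>" for x
  proof -
    have "sh (cc x) = (\<lambda>i. x i / (2 * a))" using x(1) by (auto simp: sh_def cc_def Dsk_def)
    then show ?thesis using G(3)[OF cc_bdry[OF x(2,3)]] nz_scale[of "2 * a" x] a(1) by simp
  qed
  define g where "g x = (if \<forall>i<d. \<bar>x i\<bar> \<le> a then G (cc x) else f (nz x))" for x
  let ?S1 = "{x \<in> Dsk. \<forall>i<d. \<bar>x i\<bar> \<le> a}" and ?S2 = "{x \<in> Dsk. \<exists>i<d. a \<le> \<bar>x i\<bar>}"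
  have S2: "\<exists>i<d. x i \<noteq> 0" "nz x \<in> Sph" if "x \<in> ?S2" for x
  proof -
    show *: "\<exists>i<d. x i \<noteq> 0" using that a(1) by (smt (verit) mem_Collect_eq)
    show "nz x \<in> Sph" using that by (intro nz_Sph *) (auto simp: Dsk_def)
  qed
  have "closed Dsk"
  proof -
    have eq: "Dsk = {x. (\<Sum>i<d. x i ^ 2) \<le> 1} \<inter> (\<Inter>i\<in>{d..}. {x. x i = 0})" by (auto simp: Dsk_def)
    have cl1: "closed {x :: nat \<Rightarrow> real. (\<Sum>i<d. x i ^ 2) \<le> 1}"
      by (intro closed_Collect_le continuous_on_sum continuous_on_power continuous_on_coord continuous_on_const)
    have cl2: "closed (\<Inter>i\<in>{d..}. {x :: nat \<Rightarrow> real. x i = 0})"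
      by (intro closed_INT ballI closed_Collect_eq continuous_on_coord continuous_on_const)
    show ?thesis unfolding eq using cl1 cl2 by (rule closed_Int)
  qed
  have cl1: "closed ?S1"
  proof -
    have eq: "?S1 = Dsk \<inter> (\<Inter>i\<in>{..<d}. {x. \<bar>x i\<bar> \<le> a})" by auto
    have cl: "closed (\<Inter>i\<in>{..<d}. {x :: nat \<Rightarrow> real. \<bar>x i\<bar> \<le> a})"
      by (intro closed_INT ballI closed_Collect_le continuous_on_rabs continuous_on_coord continuous_on_const)
    show ?thesis unfolding eq using \<open>closed Dsk\<close> cl by (rule closed_Int)
  qed
  have cl2: "closed ?S2"
  proof -
    have eq: "?S2 = Dsk \<inter> (\<Union>i\<in>{..<d}. {x. a \<le> \<bar>x i\<bar>})" by auto
    have cl: "closed (\<Union>i\<in>{..<d}. {x :: nat \<Rightarrow> real. a \<le> \<bar>x i\<bar>})"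
      by (intro closed_UN ballI closed_Collect_le continuous_on_rabs continuous_on_coord continuous_on_const finite_lessThan)
    show ?thesis unfolding eq using \<open>closed Dsk\<close> cl by (rule closed_Int)
  qed
  have "continuous_on (?S1 \<union> ?S2) g"
    unfolding g_def
  proof (rule continuous_on_cases[OF cl1 cl2])
    show "continuous_on ?S1 (\<lambda>x. G (cc x))"
      by (rule continuous_on_compose2[OF G(1) cont_cc]) (use cc_box in blast)
    show "continuous_on ?S2 (\<lambda>x. f (nz x))"
      by (rule continuous_on_compose2[OF f(1) cont_nz]) (use S2 in blast)+
    show "\<forall>x. x \<in> ?S1 \<and> \<not> (\<forall>i<d. \<bar>x i\<bar> \<le> a) \<or> x \<in> ?S2 \<and> (\<forall>i<d. \<bar>x i\<bar> \<le> a) \<longrightarrow> G (cc x) = f (nz x)"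
      using overlap by blast
  qed
  moreover have Dsk_eq: "?S1 \<union> ?S2 = Dsk"
  proof -
    have "x \<in> ?S2" if "x \<in> Dsk" "x \<notin> ?S1" for x using that by force
    then show ?thesis by blast
  qed
  ultimately have "continuous_on Dsk g" by simp
  moreover have "g \<in> Dsk \<rightarrow> realization K"
  proof
    fix x assume x: "x \<in> Dsk"
    show "g x \<in> realization K"
    proof (cases "\<forall>i<d. \<bar>x i\<bar> \<le> a")
      case True
      then show ?thesis using G(2) cc_box by (auto simp: g_def)
    next
      case False
      then have "x \<in> ?S2" using x Dsk_eq by blast
      then have "f (nz x) \<in> realization K" using S2(2) f(2) by blast
      moreover have "g x = f (nz x)" unfolding g_def by (rule if_not_P[OF False])
      ultimately show ?thesis by simp
    qed
  qed
  moreover have "g x = f x" if x: "x \<in> Sph" for x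
  proof -
    have "r x = 1" using x by (simp add: r_def Sph_def)
    then have nzx: "nz x = x" by (simp add: nz_def)
    show ?thesis
    proof (cases "\<forall>i<d. \<bar>x i\<bar> \<le> a")
      \<comment> \<open>A point of the sphere in the cube must lie on the boundary of the cube,
        where both formulas agree. This occurs only for \<open>d = 1\<close>, when the cube is the
        whole disk.\<close>
      case True
      have "\<exists>i<d. a \<le> \<bar>x i\<bar>"
      proof (rule ccontr)
        assume neg: "\<not> ?thesis"
        have "(\<Sum>i<d. x i ^ 2) < (\<Sum>i<d. a\<^sup>2)"
        proof (rule sum_strict_mono)
          show "x i ^ 2 < a\<^sup>2" if "i \<in> {..<d}" for i
            using neg that a(1) by (simp add: abs_square_less_1 power2_strict_mono not_le)
        qed (use d in auto)
        then show False using x a(2) by (simp add: Sph_def)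
      qed
      moreover have "x \<in> Dsk" using x by (simp add: Sph_def Dsk_def)
      ultimately show ?thesis using overlap True nzx by (simp add: g_def)
    qed (auto simp: g_def nzx)
  qed
  ultimately show "\<exists>g. continuous_map (disk (m + 1)) (top_of_set (realization K)) g \<and>
      (\<forall>x\<in>topspace (nsphere m). g x = f x)"
    unfolding disk_eq nsphere_eq Sph_def Dsk_def d_def by (intro exI[of _ g]) auto
qed

section \<open>Chordal graphs\<close>

text \<open>Every vertex of the walk except possibly the first lies in \<open>W\<close>; the start
  is constrained separately where symmetry or membership is wanted.\<close>

definition reach :: "('a \<Rightarrow> 'a \<Rightarrow> bool) \<Rightarrow> 'a set \<Rightarrow> 'a \<Rightarrow> 'a \<Rightarrow> bool" where
  "reach E W = (\<lambda>a b. E a b \<and> b \<in> W)\<^sup>*\<^sup>*"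

lemma reach_refl [simp]: "reach E W x x"
  by (simp add: reach_def)

lemma reach_step: "reach E W x y \<Longrightarrow> E y z \<Longrightarrow> z \<in> W \<Longrightarrow> reach E W x z"
  unfolding reach_def by (rule rtranclp.rtrancl_into_rtrancl) auto

lemma reach_step_start: "E x y \<Longrightarrow> y \<in> W \<Longrightarrow> reach E W y z \<Longrightarrow> reach E W x z"
  unfolding reach_def by (rule converse_rtranclp_into_rtranclp) auto

lemma reach_trans: "reach E W x y \<Longrightarrow> reach E W y z \<Longrightarrow> reach E W x z"
  unfolding reach_def by (rule rtranclp_trans)

lemma reach_mono: "reach E W x y \<Longrightarrow> W \<subseteq> W' \<Longrightarrow> reach E W' x y"
  unfolding reach_def by (erule rtranclp_mono[THEN predicate2D, rotated]) auto

lemma reach_induct [consumes 1, case_names base step]: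
  assumes "reach E W x y" "P x"
    "\<And>y z. reach E W x y \<Longrightarrow> P y \<Longrightarrow> E y z \<Longrightarrow> z \<in> W \<Longrightarrow> P z"
  shows "P y"
  using assms(1)[unfolded reach_def]
proof (induction rule: rtranclp_induct)
  case (step y z)
  then show ?case using assms(3)[of y z] by (simp add: reach_def)
qed (rule assms(2))

lemma reach_induct_start [consumes 1, case_names base step]:
  assumes "reach E W x y" "P y"
    "\<And>x z. E x z \<Longrightarrow> z \<in> W \<Longrightarrow> reach E W z y \<Longrightarrow> P z \<Longrightarrow> P x"
  shows "P x"
  using assms(1)[unfolded reach_def]
proof (induction rule: converse_rtranclp_induct)
  case (step x z)
  then show ?case using assms(3)[of x z] by (simp add: reach_def)
qed (rule assms(2))

lemma reach_in: "reach E W x y \<Longrightarrow> x \<in> W \<Longrightarrow> y \<in> W"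
  by (induction rule: reach_induct) auto

section \<open>Cliques, simplicial vertices and separators of a relation\<close>

definition nbrs :: "('a \<Rightarrow> 'a \<Rightarrow> bool) \<Rightarrow> 'a set \<Rightarrow> 'a \<Rightarrow> 'a set" where
  "nbrs E U v = {w \<in> U. E v w}"

definition clique :: "('a \<Rightarrow> 'a \<Rightarrow> bool) \<Rightarrow> 'a set \<Rightarrow> bool" where
  "clique E Q \<longleftrightarrow> (\<forall>x\<in>Q. \<forall>y\<in>Q. x \<noteq> y \<longrightarrow> E x y)"

definition simplicial :: "('a \<Rightarrow> 'a \<Rightarrow> bool) \<Rightarrow> 'a set \<Rightarrow> 'a \<Rightarrow> bool" where
  "simplicial E U u \<longleftrightarrow> clique E (nbrs E U u)"

text \<open>\<open>(n + 1)\<close>-connectivity in separator form, linked to disjoint paths by the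
  easy half of Menger's theorem. In this form it passes to a smaller vertex set by rerouting single
  walks.\<close>

definition no_small_separator :: "('a \<Rightarrow> 'a \<Rightarrow> bool) \<Rightarrow> nat \<Rightarrow> 'a set \<Rightarrow> bool" where
  "no_small_separator E n U \<longleftrightarrow> n + 2 \<le> card U \<and>
     (\<forall>S\<subseteq>U. card S \<le> n \<longrightarrow> (\<forall>x\<in>U - S. \<forall>y\<in>U - S. reach E (U - S) x y))"

lemma nbrs_subset: "nbrs E U v \<subseteq> U"
  by (auto simp: nbrs_def)

lemma in_nbrs: "w \<in> nbrs E U v \<longleftrightarrow> w \<in> U \<and> E v w"
  by (auto simp: nbrs_def)

lemma cliqueD: "clique E Q \<Longrightarrow> x \<in> Q \<Longrightarrow> y \<in> Q \<Longrightarrow> x \<noteq> y \<Longrightarrow> E x y"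
  by (auto simp: clique_def)

lemma cyclic_successor_iff:
  fixes i j m :: nat
  assumes "i < j" "j < m"
  shows "(j = (i + 1) mod m \<or> i = (j + 1) mod m) \<longleftrightarrow> (j = i + 1 \<or> (i = 0 \<and> j = m - 1))"
proof -
  have 1: "(i + 1) mod m = i + 1" using assms by simp
  show ?thesis
  proof (cases "j = m - 1")
    case True
    then have "(j + 1) mod m = 0" using assms by simp
    then show ?thesis using 1 True by auto
  next
    case False
    then have "(j + 1) mod m = j + 1" using assms by simp
    then show ?thesis using 1 False assms by auto
  qed
qed

text \<open>Induced subgraphs are represented by vertex sets \<open>U\<close> alone: excluding
  induced cycles for the whole relation excludes them inside every \<open>U\<close>, so inductions
  on \<open>U\<close> need not carry chordality along.\<close>

locale chordal_relation =
  fixes E :: "'a \<Rightarrow> 'a \<Rightarrow> bool"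
  assumes symE: "E x y \<Longrightarrow> E y x"
    and irrE: "\<not> E x x"
    and no_induced_cycle: "4 \<le> (m::nat) \<Longrightarrow> inj_on c {..<m} \<Longrightarrow>
      \<not> (\<forall>i<m. \<forall>j<m. E (c i) (c j) \<longleftrightarrow> (j = (i + 1) mod m \<or> i = (j + 1) mod m))"
begin

lemma no_induced_cycle':
  assumes m: "4 \<le> m" and inj: "inj_on c {..<m}"
    and adj: "\<And>i j::nat. i < j \<Longrightarrow> j < m \<Longrightarrow> E (c i) (c j) \<longleftrightarrow> (j = i + 1 \<or> (i = 0 \<and> j = m - 1))"
  shows False
proof -
  have "E (c i) (c j) \<longleftrightarrow> (j = (i + 1) mod m \<or> i = (j + 1) mod m)" if "i < m" "j < m" for i j
  proof (cases i j rule: linorder_cases)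
    case less
    then show ?thesis using adj[of i j] cyclic_successor_iff[of i j m] that by simp
  next
    case equal
    have "j \<noteq> (j + 1) mod m"
      using m that by (cases "j + 1 = m") auto
    then show ?thesis using equal irrE by simp
  next
    case greater
    have "E (c i) (c j) \<longleftrightarrow> E (c j) (c i)" using symE by blast
    then show ?thesis using greater adj[of j i] cyclic_successor_iff[of j i m] that by auto
  qed
  then show False using no_induced_cycle[OF m inj] by blast
qed

lemma reach_sym:
  assumes "reach E W x y" "x \<in> W"
  shows "reach E W y x"
  using assms
proof (induction rule: reach_induct)
  case (step y z)
  then show ?case using reach_step_start[of E z y W x] symE reach_in by metis
qed simp

text \<open>
  A shortest walk from a neighbour of \<open>s\<close> to \<open>y\<close> closes up through \<open>k\<close> to an induced cycle
  unless \<open>s\<close> and \<open>y\<close> are adjacent.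
\<close>

lemma chord_lemma:
  assumes sx: "E s x" and xD: "x \<in> insert y D" and xy: "reach E (insert y D) x y"
    and ky: "E k y" and sk: "E s k" and kD: "\<And>z. z \<in> D \<Longrightarrow> \<not> E k z"
    and nin: "s \<notin> D" "k \<notin> D" "s \<noteq> y"
  shows "E s y"
proof (rule ccontr)
  assume nsy: "\<not> E s y"
  define P where "P r \<longleftrightarrow> (\<exists>p. E s (p 0) \<and> p r = y \<and> (\<forall>i<r. E (p i) (p (Suc i))) \<and> (\<forall>i\<le>r. p i \<in> insert y D))" for r :: nat
  have "\<exists>r p. p 0 = x \<and> p r = y \<and> (\<forall>i<r. E (p i) (p (Suc i))) \<and> (\<forall>i\<le>r::nat. p i \<in> insert y D)"
    using xy xD
  proof (induction rule: reach_induct_start)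
    case base
    then show ?case by (intro exI[of _ 0] exI[of _ "\<lambda>_. y"]) auto
  next
    case (step x z)
    then obtain r p where p: "p 0 = z" "p r = y" "\<forall>i<r. E (p i) (p (Suc i))" "\<forall>i\<le>r. p i \<in> insert y D"
      by blast
    show ?case
      using p step.hyps(1) step.prems
      by (intro exI[of _ "Suc r"] exI[of _ "case_nat x p"]) (auto simp: less_Suc_eq_0_disj le_Suc_eq split: nat.splits)
  qed
  then have "\<exists>r. P r" unfolding P_def using sx by metis
  then obtain r where r: "P r" and rmin: "\<And>r'. r' < r \<Longrightarrow> \<not> P r'"
    using exists_least_iff[of P] by blast
  obtain p where p0: "E s (p 0)" and pr: "p r = y" and pE: "\<And>i. i < r \<Longrightarrow> E (p i) (p (Suc i))"
    and pin: "\<And>i. i \<le> r \<Longrightarrow> p i \<in> insert y D" using r unfolding P_def by blast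
  have start: "i = 0" if "i \<le> r" "E s (p i)" for i
  proof (rule ccontr)
    assume "i \<noteq> 0"
    have "P (r - i)" unfolding P_def
      using that pr pE pin by (intro exI[of _ "\<lambda>l. p (l + i)"]) auto
    then show False using rmin[of "r - i"] \<open>i \<noteq> 0\<close> that by simp
  qed
  have noty: "p i \<noteq> y" if "i < r" for i
  proof
    assume "p i = y"
    then have "P i" unfolding P_def using that p0 pE pin by (intro exI[of _ p]) auto
    then show False using rmin that by blast
  qed
  have nochord: "j = Suc i" if "i < j" "j \<le> r" "E (p i) (p j)" for i j
  proof (rule ccontr)
    assume "j \<noteq> Suc i"
    then have ij: "Suc i < j" using that by simp
    \<comment> \<open>The chord replaces the stretch between positions \<open>i\<close> and
      \<open>j\<close>, so the walk becomes shorter by \<open>j - Suc i\<close>.\<close>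
    let ?q = "\<lambda>l. if l \<le> i then p l else p (l + (j - Suc i))"
    have "P (r - (j - Suc i))"
      unfolding P_def
    proof (intro exI[of _ ?q] conjI allI impI)
      show "E s (?q 0)" using p0 by simp
      show "?q (r - (j - Suc i)) = y" using ij that pr by auto
      fix l
      show "?q l \<in> insert y D" if "l \<le> r - (j - Suc i)" using that ij \<open>j \<le> r\<close> pin by auto
      show "E (?q l) (?q (Suc l))" if "l < r - (j - Suc i)"
      proof (cases "l = i")
        case True
        have "Suc i + (j - Suc i) = j" using ij by simp
        then show ?thesis using True \<open>E (p i) (p j)\<close> by simp
      next
        case False
        then show ?thesis using that ij \<open>j \<le> r\<close> pE[of l] pE[of "l + (j - Suc i)"] by auto
      qed
    qed
    moreover have "r - (j - Suc i) < r" using ij \<open>j \<le> r\<close> by arith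
    ultimately show False using rmin by blast
  qed
  have dist: "p i \<noteq> p j" if "i < j" "j \<le> r" for i j
  proof
    assume eq: "p i = p j"
    show False
    proof (cases "j = r")
      case True
      then show False using eq noty[of i] pr that by simp
    next
      case False
      then have "E (p i) (p (Suc j))" using pE[of j] eq that by simp
      then have "Suc j = Suc i" using nochord[of i "Suc j"] that False by simp
      then show False using that by simp
    qed
  qed
  have r1: "1 \<le> r" using nsy p0 pr by (cases r) auto
  have pD: "p i \<in> D" if "i < r" for i using pin[of i] noty[OF that] that by simp
  \<comment> \<open>The cycle is \<open>s, p 0, ..., p r = y, k\<close>. It has
    \<open>r + 3 \<ge> 4\<close> vertices, because \<open>r = 0\<close> would mean that
    \<open>s\<close> and \<open>y\<close> are adjacent.\<close>
  define c where "c i = (if i = 0 then s else if i \<le> r + 1 then p (i - 1) else k)" for i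
  have "s \<noteq> k" using sk irrE by blast
  have spi: "s \<noteq> p i" if "i \<le> r" for i using pin[OF that] nin by auto
  have kpi: "k \<noteq> p i" if "i \<le> r" for i using pin[OF that] nin ky irrE by auto
  show False
  proof (rule no_induced_cycle'[of "r + 3" c])
    show "4 \<le> r + 3" using r1 by simp
    show "inj_on c {..<r + 3}"
    proof (rule linorder_inj_onI')
      fix i j assume ij: "i \<in> {..<r + 3}" "j \<in> {..<r + 3}" "i < j"
      show "c i \<noteq> c j"
      proof (cases "i = 0")
        case True
        then show ?thesis using ij spi[of "j - 1"] \<open>s \<noteq> k\<close> by (auto simp: c_def)
      next
        case False
        then have ci: "c i = p (i - 1)" "i - 1 \<le> r" using ij by (auto simp: c_def)
        show ?thesis
        proof (cases "j = r + 2")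
          case True
          then have "c j = k" by (simp add: c_def)
          then show ?thesis using ci(1) kpi[OF ci(2)] by metis
        next
          case j: False
          then have "c j = p (j - 1)" using ij by (auto simp: c_def)
          moreover have "i - 1 < j - 1" "j - 1 \<le> r" using ij j False by auto
          ultimately show ?thesis using ci dist by simp
        qed
      qed
    qed
    fix i j assume ij: "i < j" "j < r + 3"
    show "E (c i) (c j) \<longleftrightarrow> (j = i + 1 \<or> (i = 0 \<and> j = r + 3 - 1))"
    proof (cases "j = r + 2")
      case j: True
      then have cj: "c j = k" by (simp add: c_def)
      show ?thesis
      proof (cases "i = 0")
        case True
        then show ?thesis using cj j sk by (simp add: c_def)
      next
        case False
        then have ci: "c i = p (i - 1)" using ij j by (simp add: c_def)
        show ?thesis
        proof (cases "i = r + 1")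
          case True
          then show ?thesis using ci cj j ky symE pr by auto
        next
          case False
          then have "\<not> E k (p (i - 1))" using kD pD[of "i - 1"] \<open>i \<noteq> 0\<close> ij j by auto
          then show ?thesis using ci cj j False \<open>i \<noteq> 0\<close> symE by auto
        qed
      qed
    next
      case j: False
      then have cj: "c j = p (j - 1)" using ij by (simp add: c_def)
      show ?thesis
      proof (cases "i = 0")
        case True
        have "j - 1 \<le> r" using ij j by arith
        then have "E s (p (j - 1)) \<longleftrightarrow> j = 1" using start[of "j - 1"] p0 ij True by (cases "j = 1") auto
        then show ?thesis using True cj j by (simp add: c_def)
      next
        case False
        then have ci: "c i = p (i - 1)" using ij j by (simp add: c_def)
        have "E (p (i - 1)) (p (j - 1)) \<longleftrightarrow> j = i + 1"
        proof
          assume *: "E (p (i - 1)) (p (j - 1))"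
          have "i - 1 < j - 1" "j - 1 \<le> r" using ij j False by arith+
          from nochord[OF this *] show "j = i + 1" using ij False by simp
        next
          assume "j = i + 1"
          then show "E (p (i - 1)) (p (j - 1))" using pE[of "i - 1"] ij j False by auto
        qed
        then show ?thesis using ci cj j False by simp
      qed
    qed
  qed
qed

section \<open>Components, their attachments and simplicial vertices\<close>

lemma reach_component:
  assumes "reach E W c x"
  shows "reach E {w. reach E W c w} c x"
  using assms
proof (induction rule: reach_induct)
  case (step y z)
  then show ?case by (auto intro: reach_step)
qed simp

lemma reach_component2:
  assumes "reach E W c x" "reach E W c y"
  shows "reach E {w. reach E W c w} x y"
  using reach_trans[OF reach_sym[OF reach_component[OF assms(1)]] reach_component[OF assms(2)]] by simp

text \<open>The familiar fact that minimal separators of chordal graphs are cliques. Two attachment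
  vertices are joined by a walk through \<open>C\<close> and also through \<open>v\<close>, and
  \<open>v\<close> has no neighbour in \<open>C\<close>, so \<open>chord_lemma\<close> with
  \<open>k = v\<close> makes them adjacent.\<close>

lemma component_attachment_clique:
  fixes U v c
  defines "W \<equiv> U - {v} - nbrs E U v"
  defines "C \<equiv> {w. reach E W c w}"
  assumes c: "c \<in> W"
  shows "clique E {s \<in> nbrs E U v. \<exists>x\<in>C. E s x}"
  unfolding clique_def
proof (intro ballI impI)
  fix s t assume s: "s \<in> {s \<in> nbrs E U v. \<exists>x\<in>C. E s x}" and t: "t \<in> {s \<in> nbrs E U v. \<exists>x\<in>C. E s x}"
    and st: "s \<noteq> t"
  have CW: "C \<subseteq> W" using reach_in c unfolding C_def by fast
  obtain x x' where x: "x \<in> C" "E s x" and x': "x' \<in> C" "E t x'" using s t by blast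
  show "E s t"
  proof (rule chord_lemma[of s x t C v])
    have "reach E C x x'" using reach_component2 x(1) x'(1) unfolding C_def by blast
    then show "reach E (insert t C) x t"
      using reach_step[of E "insert t C" x x' t] reach_mono[of E C x x' "insert t C"] symE[OF x'(2)] by auto
  qed (use s t st x CW symE in \<open>auto simp: W_def in_nbrs\<close>)
qed

text \<open>Dirac's theorem on simplicial vertices, strengthened so that the induction closes. For a
  component \<open>C\<close> of the non-neighbours of \<open>v\<close>, the attachment set
  \<open>S\<close> is a clique, and it becomes the clique to be avoided in the smaller set
  \<open>C \<union> S\<close>.\<close>

lemma ex_simplicial_outside_clique:
  assumes "finite U" "Q \<subseteq> U" "Q \<noteq> U" "clique E Q"
  shows "\<exists>u\<in>U - Q. simplicial E U u"
  using assms
proof (induction U arbitrary: Q rule: finite_psubset_induct)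
  case (psubset U)
  show ?case
  proof (cases "clique E U")
    case True
    then show ?thesis using psubset.prems by (auto simp: simplicial_def clique_def in_nbrs)
  next
    case False
    let ?uni = "\<lambda>v. U \<subseteq> insert v (nbrs E U v)"
    have "\<exists>v\<in>U. \<not> ?uni v" using False unfolding clique_def by (force simp: in_nbrs)
    \<comment> \<open>\<open>Q\<close> must lie in the closed neighbourhood of \<open>v\<close>, so
      that \<open>C\<close> avoids \<open>Q\<close>. Any non-universal vertex of \<open>Q\<close>
      will do; if all of \<open>Q\<close> is universal, so will any non-universal vertex of
      \<open>U\<close>.\<close>
    then obtain v where v: "v \<in> U" "\<not> ?uni v" "Q \<subseteq> insert v (nbrs E U v)"
    proof (cases "\<exists>v\<in>Q. \<not> ?uni v")
      case True
      then obtain v where "v \<in> Q" "\<not> ?uni v" by blast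
      moreover have "Q \<subseteq> insert v (nbrs E U v)"
        using \<open>v \<in> Q\<close> psubset.prems by (auto simp: in_nbrs clique_def)
      ultimately show ?thesis using that psubset.prems by blast
    next
      case False
      obtain v where "v \<in> U" "\<not> ?uni v" using \<open>\<exists>v\<in>U. \<not> ?uni v\<close> by blast
      moreover have "Q \<subseteq> insert v (nbrs E U v)"
      proof
        fix q assume "q \<in> Q"
        then have "v \<in> insert q (nbrs E U q)" using False \<open>v \<in> U\<close> by blast
        then show "q \<in> insert v (nbrs E U v)" using \<open>q \<in> Q\<close> psubset.prems(1) symE by (auto simp: in_nbrs)
      qed
      ultimately show ?thesis using that by blast
    qed
    then obtain c where c: "c \<in> U - {v} - nbrs E U v" by blast
    define W where "W = U - {v} - nbrs E U v"
    define C where "C = {w. reach E W c w}"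
    define S where "S = {s \<in> nbrs E U v. \<exists>x\<in>C. E s x}"
    have cC: "c \<in> C" by (simp add: C_def)
    have CW: "C \<subseteq> W" using reach_in c unfolding C_def W_def by fast
    have clS: "clique E S"
      unfolding S_def C_def W_def by (rule component_attachment_clique[OF c])
    have "\<exists>u\<in>(C \<union> S) - S. simplicial E (C \<union> S) u"
    proof (rule psubset.IH)
      show "C \<union> S \<subset> U" using CW v(1) unfolding W_def S_def by (auto simp: in_nbrs irrE)
      show "S \<noteq> C \<union> S" using cC CW unfolding W_def S_def by auto
    qed (use clS in auto)
    then obtain u where u: "u \<in> C" "simplicial E (C \<union> S) u" by blast
    \<comment> \<open>A vertex of \<open>C\<close> has no neighbours beyond
      \<open>C \<union> S\<close>, so being simplicial there is the same as being simplicial in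
      \<open>U\<close>.\<close>
    have "nbrs E U u \<subseteq> C \<union> S"
    proof
      fix z assume z: "z \<in> nbrs E U u"
      then have "E z u" "E u z" "z \<in> U" using symE by (auto simp: in_nbrs)
      have "z \<noteq> v" using \<open>E z u\<close> u(1) CW by (auto simp: W_def in_nbrs)
      show "z \<in> C \<union> S"
      proof (cases "z \<in> nbrs E U v")
        case True
        then show ?thesis using u(1) \<open>E z u\<close> by (auto simp: S_def)
      next
        case False
        then have "z \<in> W" using \<open>z \<noteq> v\<close> \<open>z \<in> U\<close> by (simp add: W_def)
        then show ?thesis using u(1) \<open>E u z\<close> reach_step unfolding C_def by fast
      qed
    qed
    moreover have "C \<union> S \<subseteq> U" using CW by (auto simp: W_def S_def in_nbrs)
    ultimately have "nbrs E U u = nbrs E (C \<union> S) u" by (auto simp: in_nbrs)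
    then have "simplicial E U u" using u(2) by (simp add: simplicial_def)
    moreover have "u \<in> U - Q" using u(1) CW v(3) by (auto simp: W_def)
    ultimately show ?thesis by blast
  qed
qed

text \<open>Cutting the walk at its first vertex adjacent to \<open>k\<close> produces the shape
  that \<open>chord_lemma\<close> expects: nothing before the end point \<open>y\<close> is adjacent
  to \<open>k\<close>.\<close>

lemma first_hit:
  assumes "reach E C x z" "x \<in> C" "E k z"
  shows "\<exists>y\<in>C. E k y \<and> x \<in> insert y {w \<in> C. \<not> E k w} \<and> reach E (insert y {w \<in> C. \<not> E k w}) x y"
  using assms
proof (induction rule: reach_induct_start)
  case base
  then show ?case by auto
next
  case (step x w)
  show ?case
  proof (cases "E k x")
    case True
    then show ?thesis using step.prems by auto
  next
    case False
    obtain y where y: "y \<in> C" "E k y" "w \<in> insert y {w \<in> C. \<not> E k w}" "reach E (insert y {w \<in> C. \<not> E k w}) w y"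
      using step by blast
    have "reach E (insert y {w \<in> C. \<not> E k w}) x y"
      using reach_step_start[OF step.hyps(1) y(3,4)] .
    then show ?thesis using y False step.prems by blast
  qed
qed

text \<open>The vertices of \<open>K\<close> attached to a component \<open>C\<close> outside the
  closed neighbourhood of \<open>u\<close> separate \<open>C\<close> from \<open>u\<close>; there
  are at least \<open>n + 1\<close> of them, which is all of \<open>K\<close>. Take \<open>x\<close>
  in \<open>C\<close> with the most neighbours in \<open>K\<close>. If it missed some
  \<open>k\<close>, walk in \<open>C\<close> from \<open>x\<close> to the first neighbour
  \<open>y\<close> of \<open>k\<close>. By \<open>chord_lemma\<close>, \<open>y\<close> is adjacent
  to every neighbour of \<open>x\<close> in \<open>K\<close>, and to \<open>k\<close> as well,
  against maximality.\<close>

lemma common_neighbour_outside: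
  assumes U: "finite U" "no_small_separator E n U" and u: "u \<in> U" "simplicial E U u"
    and K: "card (nbrs E U u) = n + 1" and big: "n + 3 \<le> card U"
  shows "\<exists>x\<in>U. x \<noteq> u \<and> nbrs E U u \<subseteq> nbrs E U x"
proof -
  let ?K = "nbrs E U u"
  have finK: "finite ?K" using U(1) nbrs_subset finite_subset by metis
  define W where "W = U - {u} - ?K"
  have "W \<noteq> {}"
  proof
    assume "W = {}"
    then have "U \<subseteq> insert u ?K" by (auto simp: W_def)
    then have "card U \<le> card (insert u ?K)" using finK by (intro card_mono) auto
    also have "\<dots> \<le> n + 2" using K finK by (simp add: card_insert_if)
    finally show False using big by simp
  qed
  then obtain c where c: "c \<in> W" by blast
  define C where "C = {w. reach E W c w}"
  have cC: "c \<in> C" by (simp add: C_def)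
  have CW: "C \<subseteq> W" using reach_in c unfolding C_def by fast
  define S where "S = {k \<in> ?K. \<exists>x\<in>C. E k x}"
  have stay: "z \<in> C" if "reach E (U - S) c z" for z
    using that
  proof (induction rule: reach_induct)
    case (step y z)
    have "z \<noteq> u" using step CW symE by (auto simp: W_def in_nbrs)
    moreover have "z \<notin> ?K" using step symE by (auto simp: S_def)
    ultimately have "z \<in> W" using step by (auto simp: W_def)
    then show ?case using step reach_step unfolding C_def by fast
  qed (rule cC)
  have SK: "S \<subseteq> ?K" by (auto simp: S_def)
  have "\<not> card S \<le> n"
  proof
    assume "card S \<le> n"
    moreover have "S \<subseteq> U" using SK nbrs_subset by fast
    moreover have "c \<in> U - S" "u \<in> U - S" using c u(1) SK irrE by (auto simp: W_def in_nbrs)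
    ultimately have "reach E (U - S) c u" using U(2) unfolding no_small_separator_def by blast
    then show False using stay CW by (auto simp: W_def)
  qed
  then have SeqK: "S = ?K" using SK finK K by (intro card_seteq) auto
  have finC: "finite C" using CW U(1) finite_subset unfolding W_def by blast
  obtain x where x: "x \<in> C" and xmax: "\<And>y. y \<in> C \<Longrightarrow> card (nbrs E ?K y) \<le> card (nbrs E ?K x)"
    using Max_in[of "(\<lambda>x. card (nbrs E ?K x)) ` C"] Max_ge[of "(\<lambda>x. card (nbrs E ?K x)) ` C"] finC cC
    by (smt (verit, ccfv_SIG) empty_iff finite_imageI imageE image_eqI image_is_empty)
  have "E x k" if k: "k \<in> ?K" for k
  proof (rule ccontr)
    assume nxk: "\<not> E x k"
    obtain z where z: "z \<in> C" "E k z" using k SeqK by (auto simp: S_def)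
    have "reach E C x z" using reach_component2 x z(1) unfolding C_def by blast
    from first_hit[OF this x z(2)] obtain y where y: "y \<in> C" "E k y" "x \<in> insert y {w \<in> C. \<not> E k w}"
      "reach E (insert y {w \<in> C. \<not> E k w}) x y" by blast
    have KC: "w \<notin> C" if "w \<in> ?K" for w using that CW by (auto simp: W_def)
    have "E s y" if s: "s \<in> nbrs E ?K x" for s
    proof (rule chord_lemma[of s x y "{w \<in> C. \<not> E k w}" k])
      have sK: "s \<in> ?K" "E x s" using s by (auto simp: in_nbrs)
      show "E s x" using sK symE by blast
      have "s \<noteq> k" using sK nxk by blast
      then show "E s k" using cliqueD[OF u(2)[unfolded simplicial_def] sK(1) k] by blast
      show "s \<notin> {w \<in> C. \<not> E k w}" "k \<notin> {w \<in> C. \<not> E k w}" "s \<noteq> y"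
        using KC sK(1) k y(1) by blast+
    qed (use y in auto)
    then have "nbrs E ?K x \<subseteq> nbrs E ?K y" using symE by (auto simp: in_nbrs)
    moreover have "k \<in> nbrs E ?K y" "k \<notin> nbrs E ?K x" using y(2) k nxk symE by (auto simp: in_nbrs)
    ultimately have "nbrs E ?K x \<subset> nbrs E ?K y" by blast
    moreover have "finite (nbrs E ?K y)" using finK nbrs_subset finite_subset by metis
    ultimately have "card (nbrs E ?K x) < card (nbrs E ?K y)" using psubset_card_mono by blast
    then show False using xmax[OF y(1)] by simp
  qed
  then have "?K \<subseteq> nbrs E U x" by (auto simp: in_nbrs)
  moreover have "x \<in> U" "x \<noteq> u" using x CW by (auto simp: W_def)
  ultimately show ?thesis by blast
qed

text \<open>Otherwise the neighbourhood of \<open>u\<close> would be a small separator; the lower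
  bound on \<open>card U\<close> guarantees a vertex on the other side.\<close>

lemma card_nbrs_ge:
  assumes "finite U" "no_small_separator E n U" "u \<in> U"
  shows "n + 1 \<le> card (nbrs E U u)"
proof (rule ccontr)
  assume "\<not> ?thesis"
  then have small: "card (nbrs E U u) \<le> n" by simp
  let ?S = "nbrs E U u"
  have finS: "finite ?S" using assms(1) nbrs_subset finite_subset by metis
  have "\<not> U \<subseteq> insert u ?S"
  proof
    assume "U \<subseteq> insert u ?S"
    then have "card U \<le> card (insert u ?S)" using finS by (intro card_mono) auto
    also have "\<dots> \<le> n + 1" using small finS by (simp add: card_insert_if)
    finally show False using assms(2) by (simp add: no_small_separator_def)
  qed
  then obtain w where w: "w \<in> U" "w \<noteq> u" "w \<notin> ?S" by blast
  have "u \<notin> ?S" using irrE by (simp add: in_nbrs)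
  then have "reach E (U - ?S) u w"
    using assms(2,3) w small nbrs_subset[of E U u] unfolding no_small_separator_def by blast
  then have "w = u"
  proof (induction rule: reach_induct)
    case (step y z)
    then show ?case by (auto simp: in_nbrs)
  qed simp
  then show False using w by simp
qed

text \<open>The vertices before and after a visit to \<open>u\<close> are equal or adjacent, so the
  visit can be skipped. The second conjunct is the invariant while the walk stands at
  \<open>u\<close>: every possible next vertex is already reached without \<open>u\<close>.\<close>

lemma reach_avoid_simplicial:
  assumes "reach E W x y" "W \<subseteq> U" "simplicial E U u" "x \<in> W" "x \<noteq> u"
  shows "(y \<noteq> u \<longrightarrow> reach E (W - {u}) x y) \<and> (y = u \<longrightarrow> (\<forall>z\<in>nbrs E W u. reach E (W - {u}) x z))"
  using assms
proof (induction rule: reach_induct)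
  case base
  then show ?case by simp
next
  case (step y z)
  have yW: "y \<in> W" using reach_in step.hyps(1) step.prems by metis
  have IH: "(y \<noteq> u \<longrightarrow> reach E (W - {u}) x y) \<and> (y = u \<longrightarrow> (\<forall>z\<in>nbrs E W u. reach E (W - {u}) x z))"
    using step by blast
  show ?case
  proof (cases "y = u")
    case True
    then show ?thesis using IH step.hyps irrE by (auto simp: in_nbrs)
  next
    case yu: False
    then have xy: "reach E (W - {u}) x y" using IH by blast
    have "reach E (W - {u}) x w" if zu: "z = u" and w: "w \<in> nbrs E W u" for w
    proof (cases "w = y")
      case False
      have "y \<in> nbrs E U u" "w \<in> nbrs E U u"
        using zu step.hyps(2) yW w step.prems(1) symE by (auto simp: in_nbrs)
      then have "E y w" using step.prems(2) False by (auto simp: simplicial_def clique_def)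
      moreover have "w \<in> W - {u}" using w irrE by (auto simp: in_nbrs)
      ultimately show ?thesis using reach_step[OF xy] by blast
    qed (use xy in simp)
    then show ?thesis using reach_step[OF xy step.hyps(2)] step.hyps(3) by blast
  qed
qed

lemma no_small_separator_remove_simplicial:
  assumes U: "finite U" "no_small_separator E n U" and u: "u \<in> U" "simplicial E U u" and big: "n + 3 \<le> card U"
  shows "no_small_separator E n (U - {u})"
  unfolding no_small_separator_def
proof (intro conjI allI impI ballI)
  show "n + 2 \<le> card (U - {u})" using U(1) u(1) big by simp
  fix S x y assume S: "S \<subseteq> U - {u}" "card S \<le> n" and xy: "x \<in> U - {u} - S" "y \<in> U - {u} - S"
  have "reach E (U - S) x y" using U(2) S xy unfolding no_small_separator_def by blast
  then have "reach E (U - S - {u}) x y"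
    using reach_avoid_simplicial[of "U - S" x y U u] u(2) xy by blast
  moreover have "U - S - {u} = U - {u} - S" by blast
  ultimately show "reach E (U - {u} - S) x y" by simp
qed

lemma clique_insert_simplicial: "simplicial E U u \<Longrightarrow> clique E (insert u (nbrs E U u))"
  unfolding simplicial_def clique_def using symE in_nbrs[of _ E U u] by (metis insert_iff)

lemma ex_foldable_simplicial:
  assumes U: "finite U" "no_small_separator E n U" and big: "n + 3 \<le> card U"
    and nocl: "\<And>Q. Q \<subseteq> U \<Longrightarrow> clique E Q \<Longrightarrow> card Q \<noteq> n + 3"
  shows "\<exists>u\<in>U. simplicial E U u \<and> (\<exists>x\<in>U. x \<noteq> u \<and> nbrs E U u \<subseteq> nbrs E U x)"
proof -
  have "U \<noteq> {}" using big by auto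
  then obtain u where u: "u \<in> U" "simplicial E U u"
    using ex_simplicial_outside_clique[OF U(1), of "{}"] by (auto simp: clique_def)
  have finK: "finite (nbrs E U u)" using U(1) nbrs_subset finite_subset by metis
  have "card (insert u (nbrs E U u)) \<le> n + 2"
  proof (rule ccontr)
    assume "\<not> ?thesis"
    then have "n + 3 \<le> card (insert u (nbrs E U u))" by simp
    then obtain Q where "Q \<subseteq> insert u (nbrs E U u)" "card Q = n + 3"
      by (rule obtain_subset_with_card_n)
    moreover from this have "clique E Q"
      using clique_insert_simplicial[OF u(2)] unfolding clique_def by blast
    moreover have "insert u (nbrs E U u) \<subseteq> U" using u(1) nbrs_subset by fast
    ultimately show False using nocl[of Q] by blast
  qed
  then have "card (nbrs E U u) = n + 1"
    using card_nbrs_ge[OF U u(1)] finK irrE by (auto simp: card_insert_if in_nbrs)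
  then show ?thesis using common_neighbour_outside[OF U u _ big] u by blast
qed

lemma minimal_no_small_separator_clique:
  assumes "finite U" "no_small_separator E n U" "card U = n + 2"
  shows "clique E U"
  unfolding clique_def
proof (intro ballI impI)
  fix x y assume xy: "x \<in> U" "y \<in> U" "x \<noteq> y"
  have "nbrs E U x = U - {x}"
  proof (rule card_seteq)
    show "nbrs E U x \<subseteq> U - {x}" using irrE by (auto simp: in_nbrs)
    show "card (U - {x}) \<le> card (nbrs E U x)"
      using card_nbrs_ge[OF assms(1,2) xy(1)] assms(1,3) xy(1) by simp
  qed (use assms in simp)
  then have "y \<in> nbrs E U x" using xy by simp
  then show "E x y" by (simp add: in_nbrs)
qed

section \<open>The neighbourhood complex of a chordal graph\<close>

lemma box_connected_neighbourhoods:
  assumes "finite U" "no_small_separator E n U" "Q \<subseteq> U" "clique E Q" "card Q = n + 3"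
  shows "box_connected (Suc n) (realization (\<Union>w\<in>U. Pow (nbrs E U w)))"
  using assms
proof (induction U rule: finite_psubset_induct)
  case (psubset U)
  have finN: "finite (nbrs E W w)" if "W \<subseteq> U" for W w
    using that psubset.hyps nbrs_subset finite_subset by metis
  show ?case
  proof (cases "Q = U")
    \<comment> \<open>The induction ends at the complete graph on \<open>Q\<close>. At most
      \<open>n + 2\<close> of its \<open>n + 3\<close> vertices leave one out, and that one lies in
      all their neighbourhoods.\<close>
    case True
    show ?thesis
    proof (rule box_connected_UN_simplices)
      show "U \<noteq> {}" using True psubset.prems by auto
      fix T assume T: "T \<subseteq> U" "card T \<le> Suc (Suc n)"
      then have "T \<noteq> U" using True psubset.prems by auto
      then obtain x where "x \<in> U" "x \<notin> T" using T by blast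
      then have "x \<in> (\<Inter>w\<in>T. nbrs E U w)"
        using T cliqueD[OF psubset.prems(3)] True unfolding in_nbrs INT_iff by blast
      then show "(\<Inter>w\<in>T. nbrs E U w) \<noteq> {}" by blast
    qed (use psubset.hyps finN in auto)
  next
    case False
    then obtain u where u: "u \<in> U" "u \<notin> Q" "simplicial E U u"
      using ex_simplicial_outside_clique psubset.hyps psubset.prems by blast
    define U' where "U' = U - {u}"
    define K where "K = nbrs E U u"
    have "card Q < card U"
      using psubset.prems(2) False psubset.hyps by (simp add: psubset_card_mono psubset_eq)
    then have big: "n + 3 \<le> card U" using psubset.prems(4) by simp
    have U'U: "U' \<subseteq> U" by (auto simp: U'_def)
    have KU: "K \<subseteq> U'" using irrE by (auto simp: K_def U'_def in_nbrs)
    have finK: "finite K" using finN by (simp add: K_def)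
    have cK: "n + 1 \<le> card K"
      unfolding K_def by (rule card_nbrs_ge[OF psubset.hyps psubset.prems(1) u(1)])
    have clK: "clique E K" using u(3) by (simp add: simplicial_def K_def)
    \<comment> \<open>A proper subset of the clique \<open>K\<close> has a common neighbour in the
      rest of \<open>K\<close>. The case \<open>T = K\<close> arises only if \<open>K\<close> has
      exactly \<open>n + 1\<close> vertices, and then the common neighbour lies outside.\<close>
    have com: "\<exists>x\<in>U'. \<forall>w\<in>T. E w x" if T: "T \<subseteq> K" "card T \<le> n + 1" for T
    proof (cases "T = K")
      case True
      then have "card (nbrs E U u) = n + 1" using T(2) cK by (simp add: K_def)
      from common_neighbour_outside[OF psubset.hyps psubset.prems(1) u(1,3) this big]
      obtain x where "x \<in> U" "x \<noteq> u" "K \<subseteq> nbrs E U x" by (auto simp: K_def)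
      then show ?thesis using True symE by (intro bexI[of _ x]) (auto simp: in_nbrs U'_def)
    next
      case False
      then obtain x where x: "x \<in> K" "x \<notin> T" using T(1) by blast
      then have "\<forall>w\<in>T. E w x" using cliqueD[OF clK] T(1) by blast
      then show ?thesis using x KU by blast
    qed
    let ?A = "\<Union>w\<in>U'. Pow (nbrs E U' w)"
    have cxA: "complex_on U ?A"
      by (rule complex_on_UN_Pow) (use psubset.hyps U'U nbrs_subset[of E U'] in \<open>auto simp: finite_subset\<close>)
    have cxK: "complex_on U (Pow K)"
      using psubset.hyps KU U'U by (auto simp: complex_on_def)
    have bA: "box_connected (Suc n) (realization ?A)"
    proof (rule psubset.IH)
      show "U' \<subset> U" using u(1) by (auto simp: U'_def)
      show "no_small_separator E n U'"
        unfolding U'_def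
        by (rule no_small_separator_remove_simplicial[OF psubset.hyps psubset.prems(1) u(1,3) big])
      show "Q \<subseteq> U'" using psubset.prems(2) u(2) by (auto simp: U'_def)
    qed (use psubset.prems in auto)
    have bAK: "box_connected (Suc n) (realization (?A \<union> Pow K))"
    proof (cases "K \<in> ?A")
      case True
      then have "?A \<union> Pow K = ?A" by auto
      then show ?thesis using bA by simp
    next
      case KA: False
      have "\<not> card K \<le> n + 1"
      proof
        assume "card K \<le> n + 1"
        then obtain x where x: "x \<in> U'" "\<forall>w\<in>K. E w x" using com[of K] by blast
        then have "K \<subseteq> nbrs E U' x" using KU symE unfolding nbrs_def by blast
        then show False using KA x(1) by blast
      qed
      \<comment> \<open>When \<open>K\<close> is a new simplex, the old complex meets it in its full
        boundary, since each \<open>w\<close> in \<open>K\<close> sees the facet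
        \<open>K - {w}\<close>. As \<open>K\<close> now has at least \<open>n + 2\<close> vertices,
        this boundary is connected enough.\<close>
      have eq: "?A \<inter> Pow K = (\<Union>w\<in>K. Pow (K - {w}))"
      proof (intro equalityI subsetI)
        fix \<sigma> assume \<sigma>: "\<sigma> \<in> ?A \<inter> Pow K"
        then have "\<sigma> \<noteq> K" using KA by blast
        then show "\<sigma> \<in> (\<Union>w\<in>K. Pow (K - {w}))" using \<sigma> by blast
      next
        fix \<sigma> assume "\<sigma> \<in> (\<Union>w\<in>K. Pow (K - {w}))"
        then obtain w where w: "w \<in> K" "\<sigma> \<subseteq> K - {w}" by blast
        have "K - {w} \<subseteq> nbrs E U' w"
          using cliqueD[OF clK w(1)] KU unfolding nbrs_def by blast
        then show "\<sigma> \<in> ?A \<inter> Pow K" using w KU by blast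
      qed
      show ?thesis
      proof (rule box_connected_Un[OF cxA cxK bA])
        show "box_connected (Suc n) (realization (Pow K))"
          using finK cK by (intro box_connected_simplex) auto
        show "box_connected n (realization (?A \<inter> Pow K))"
          unfolding eq
        proof (rule box_connected_UN_simplices)
          fix T assume T: "T \<subseteq> K" "card T \<le> Suc n"
          then have "T \<noteq> K" using \<open>\<not> card K \<le> n + 1\<close> by auto
          then obtain x where "x \<in> K" "x \<notin> T" using T(1) by blast
          then have "x \<in> (\<Inter>w\<in>T. K - {w})" by auto
          then show "(\<Inter>w\<in>T. K - {w}) \<noteq> {}" by blast
        qed (use finK cK in auto)
      qed
    qed
    let ?L = "\<Union>w\<in>K. Pow (nbrs E U' w)"
    \<comment> \<open>The cone over \<open>?L\<close> with apex \<open>u\<close>: no simplex of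
      \<open>?L\<close> contains \<open>u\<close>, so \<open>u\<close> may be added or left out
      freely.\<close>
    let ?C = "{\<sigma>. \<sigma> - {u} \<in> ?L}"
    have Kne: "K \<noteq> {}" using cK by auto
    have bL: "box_connected n (realization ?L)"
    proof (rule box_connected_UN_simplices[OF finK Kne])
      fix T assume T: "T \<subseteq> K" "card T \<le> Suc n"
      then obtain x where "x \<in> U'" "\<forall>w\<in>T. E w x" using com[of T] by auto
      then have "x \<in> (\<Inter>w\<in>T. nbrs E U' w)" by (auto simp: in_nbrs)
      then show "(\<Inter>w\<in>T. nbrs E U' w) \<noteq> {}" by blast
    qed (use finN U'U in blast)
    have cxC: "complex_on U ?C"
      unfolding complex_on_def
    proof (intro conjI ballI allI impI)
      show "?C \<subseteq> Pow U" using nbrs_subset[of E U'] u(1) unfolding U'_def by blast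
      fix \<sigma> \<tau> assume "\<sigma> \<in> ?C" "\<tau> \<subseteq> \<sigma>"
      then show "\<tau> \<in> ?C" by blast
    qed (rule psubset.hyps)
    have bC: "box_connected (Suc n) (realization ?C)"
    proof (rule box_connected_cone[OF cxC])
      have "{} \<in> ?C" using Kne by blast
      then show "?C \<noteq> {}" by blast
      show "insert u \<sigma> \<in> ?C" if "\<sigma> \<in> ?C" for \<sigma> using that by simp
    qed
    have link: "(?A \<union> Pow K) \<inter> ?C = ?L"
    proof (intro equalityI subsetI)
      fix \<sigma> assume \<sigma>: "\<sigma> \<in> (?A \<union> Pow K) \<inter> ?C"
      then have "u \<notin> \<sigma>" using KU nbrs_subset[of E U'] unfolding U'_def by blast
      then show "\<sigma> \<in> ?L" using \<sigma> by simp
    next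
      fix \<sigma> assume \<sigma>: "\<sigma> \<in> ?L"
      then have "u \<notin> \<sigma>" using nbrs_subset[of E U'] unfolding U'_def by blast
      then show "\<sigma> \<in> (?A \<union> Pow K) \<inter> ?C" using \<sigma> KU by auto
    qed
    \<comment> \<open>Putting \<open>u\<close> back adds the neighbourhood \<open>K\<close> of
      \<open>u\<close>, enlarges the neighbourhoods of the vertices of \<open>K\<close> by
      \<open>u\<close>, and leaves all others unchanged.\<close>
    have "(\<Union>w\<in>U. Pow (nbrs E U w)) = (?A \<union> Pow K) \<union> ?C"
    proof (intro equalityI subsetI)
      fix \<sigma> assume "\<sigma> \<in> (\<Union>w\<in>U. Pow (nbrs E U w))"
      then obtain w where w: "w \<in> U" "\<sigma> \<subseteq> nbrs E U w" by blast
      have nw: "nbrs E U w - {u} \<subseteq> nbrs E U' w" by (auto simp: in_nbrs U'_def)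
      show "\<sigma> \<in> (?A \<union> Pow K) \<union> ?C"
      proof (cases "w = u \<or> u \<notin> \<sigma>")
        case True
        then show ?thesis using w nw unfolding K_def U'_def by blast
      next
        case False
        then have "w \<in> K" using w symE unfolding K_def nbrs_def by blast
        then show ?thesis using w nw by blast
      qed
    next
      fix \<sigma> assume "\<sigma> \<in> (?A \<union> Pow K) \<union> ?C"
      then consider w where "w \<in> U'" "\<sigma> \<subseteq> nbrs E U' w" | "\<sigma> \<subseteq> K" | w where "w \<in> K" "\<sigma> - {u} \<subseteq> nbrs E U' w"
        by blast
      then show "\<sigma> \<in> (\<Union>w\<in>U. Pow (nbrs E U w))"
      proof cases
        case 1
        then show ?thesis using U'U unfolding nbrs_def by blast
      next
        case 2
        then show ?thesis using u(1) unfolding K_def by blast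
      next
        case (3 w)
        then have "E w u" "w \<in> U" using symE by (auto simp: K_def in_nbrs)
        then have "\<sigma> \<subseteq> nbrs E U w" using 3 u(1) U'U unfolding nbrs_def by blast
        then show ?thesis using \<open>w \<in> U\<close> by blast
      qed
    qed
    moreover have "box_connected (Suc n) (realization ((?A \<union> Pow K) \<union> ?C))"
      using box_connected_Un[OF complex_on_Un[OF cxA cxK] cxC bAK bC] bL link by simp
    ultimately show ?thesis by simp
  qed
qed

end

section \<open>Transfer to digraphs\<close>

lemma arcs_ends_induce: "(x, y) \<in> arcs_ends (G \<restriction> U) \<longleftrightarrow> (x, y) \<in> arcs_ends G \<and> x \<in> U \<and> y \<in> U"
  by (auto simp: arcs_ends_conv)

lemma neighbours_induce: "v \<in> U \<Longrightarrow> neighbours (G \<restriction> U) v = nbrs (\<lambda>x y. x \<rightarrow>\<^bsub>G\<^esub> y) U v"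
  by (auto simp: neighbours_def nbrs_def arcs_ends_induce)

lemma del_vert_induce: "pre_digraph.del_vert (G \<restriction> U) u = G \<restriction> (U - {u})"
  by (auto simp: pre_digraph.del_vert_def induce_subgraph_def)

lemma (in graph) graph_induce:
  assumes "U \<subseteq> verts G"
  shows "graph (G \<restriction> U)"
proof -
  have ind: "induced_subgraph (G \<restriction> U) G" using assms by (rule induced_induce)
  interpret D: digraph "G \<restriction> U" using ind by (rule digraphI_induced)
  show ?thesis
    using induced_graph_imp_symmetric[OF sym_arcs ind] by (rule D.graphI)
qed

text \<open>An enumeration \<open>c\<close> of an induced cycle is made into an isomorphism from the
  subgraph induced on its range to \<open>cycle_graph k\<close>.\<close>

lemma (in graph) chordal_imp_chordal_relation:
  assumes "chordal G"
  shows "chordal_relation (\<lambda>x y. x \<rightarrow>\<^bsub>G\<^esub> y)"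
proof
  show "x \<rightarrow>\<^bsub>G\<^esub> y \<Longrightarrow> y \<rightarrow>\<^bsub>G\<^esub> x" for x y using sym_arcs by (rule arcs_ends_symmetric)
  show "\<not> x \<rightarrow>\<^bsub>G\<^esub> x" for x using adj_not_same by blast
  fix k :: nat and c :: "nat \<Rightarrow> 'a"
  assume k: "4 \<le> k" and inj: "inj_on c {..<k}"
  show "\<not> (\<forall>i<k. \<forall>j<k. c i \<rightarrow>\<^bsub>G\<^esub> c j \<longleftrightarrow> (j = (i + 1) mod k \<or> i = (j + 1) mod k))"
  proof
    assume adj: "\<forall>i<k. \<forall>j<k. c i \<rightarrow>\<^bsub>G\<^esub> c j \<longleftrightarrow> (j = (i + 1) mod k \<or> i = (j + 1) mod k)"
    let ?W = "c ` {..<k}"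
    have WG: "?W \<subseteq> verts G"
    proof
      fix x assume "x \<in> ?W"
      then obtain i where i: "i < k" "x = c i" by auto
      then have "c i \<rightarrow>\<^bsub>G\<^esub> c ((i + 1) mod k)" using adj k by simp
      then show "x \<in> verts G" using i by (auto simp: arcs_ends_conv)
    qed
    let ?H = "G \<restriction> ?W"
    define h where "h = the_inv_into {..<k} c"
    have hc: "h (c i) = i" if "i < k" for i
      using that inj by (simp add: h_def the_inv_into_f_f)
    have ch: "c (h x) = x" "h x < k" if "x \<in> ?W" for x using that hc by auto
    have injh: "inj_on h ?W" using hc by (auto intro!: inj_onI)
    \<comment> \<open>The arcs of \<open>cycle_graph k\<close> are pairs of vertices, so an arc is
      sent to the pair of its relabelled ends; this is injective because there are no parallel
      arcs.\<close>
    define f where "f = \<lparr>iso_verts = h, iso_arcs = (\<lambda>e. (h (tail G e), h (head G e))),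
      iso_head = snd, iso_tail = fst\<rparr>"
    have "pre_digraph.digraph_isomorphism ?H f"
      unfolding pre_digraph.digraph_isomorphism_def
    proof (intro conjI)
      show "wf_digraph ?H" by (rule wellformed_induce_subgraph)
      show "inj_on (iso_verts f) (verts ?H)" using injh by (simp add: f_def)
      show "inj_on (iso_arcs f) (arcs ?H)"
      proof (rule inj_onI)
        fix e e' assume e: "e \<in> arcs ?H" "e' \<in> arcs ?H" and eq: "iso_arcs f e = iso_arcs f e'"
        then have "tail G e = tail G e'" "head G e = head G e'"
          using inj_onD[OF injh] by (auto simp: f_def)
        then show "e = e'" using e no_multi_arcs[of e e'] by (auto simp: arc_to_ends_def)
      qed
    qed (simp add: f_def)
    moreover have "with_proj (cycle_graph k) = app_iso f ?H"
    proof -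
      have v: "h ` ?W = {..<k}" using hc by (auto simp: image_iff)
      have a: "(\<lambda>e. (h (tail G e), h (head G e))) ` arcs ?H =
          {(i, j). i < k \<and> j < k \<and> (j = (i + 1) mod k \<or> i = (j + 1) mod k)}" (is "?l = ?r")
      proof (intro equalityI subsetI)
        fix q assume "q \<in> ?l"
        then obtain e where e: "e \<in> arcs G" "tail G e \<in> ?W" "head G e \<in> ?W" "q = (h (tail G e), h (head G e))"
          by auto
        then have "c (h (tail G e)) \<rightarrow>\<^bsub>G\<^esub> c (h (head G e))" using ch by (auto simp: arcs_ends_conv)
        then show "q \<in> ?r" using adj ch(2) e by auto
      next
        fix q assume "q \<in> ?r"
        then obtain i j where ij: "q = (i, j)" "i < k" "j < k" "c i \<rightarrow>\<^bsub>G\<^esub> c j" using adj by auto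
        then obtain e where "e \<in> arcs G" "tail G e = c i" "head G e = c j" by (auto simp: arcs_ends_conv)
        then show "q \<in> ?l" using ij hc by (intro image_eqI[of _ _ e]) auto
      qed
      show ?thesis
        unfolding with_proj_def cycle_graph_def app_iso_def f_def using v a by simp
    qed
    ultimately have "digraph_iso ?H (with_proj (cycle_graph k))"
      unfolding digraph_iso_def by blast
    then show False using assms k induced_induce[OF WG] unfolding chordal_def by blast
  qed
qed

section \<open>Separators from internally disjoint paths\<close>

lemma vwalk_reach:
  assumes "p \<noteq> []" "set (vwalk_arcs p) \<subseteq> arcs_ends G" "set p \<subseteq> W"
  shows "reach (\<lambda>x y. x \<rightarrow>\<^bsub>G\<^esub> y) W (hd p) (last p)"
  using assms
proof (induction p rule: vwalk_arcs.induct)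
  case (3 x y xs)
  then show ?case using reach_step_start[of "\<lambda>x y. x \<rightarrow>\<^bsub>G\<^esub> y" x y W "last (y # xs)"] by simp
qed auto

text \<open>Pigeonhole: if every path met \<open>S\<close>, choosing a meeting point on each would
  be injective, since distinct paths share only \<open>x\<close> and \<open>y\<close>, which are not
  in \<open>S\<close>.\<close>

lemma disjoint_paths_avoid_set:
  assumes P: "internally_disjoint_paths G x y P" "finite P" "card S < card P"
    and S: "finite S" "x \<notin> S" "y \<notin> S"
  shows "\<exists>p\<in>P. set p \<inter> S = {}"
proof (rule ccontr)
  assume "\<not> ?thesis"
  then have "\<forall>p\<in>P. \<exists>s. s \<in> set p \<inter> S" by blast
  then obtain s where s: "\<And>p. p \<in> P \<Longrightarrow> s p \<in> set p \<inter> S" by metis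
  have "inj_on s P"
  proof (rule inj_onI, rule ccontr)
    fix p q assume pq: "p \<in> P" "q \<in> P" "s p = s q" "p \<noteq> q"
    then have "s p \<in> set p \<inter> set q" using s by (metis IntE IntI)
    then have "s p \<in> {x, y}" using P(1) pq unfolding internally_disjoint_paths_def by blast
    then show False using s[OF pq(1)] S by auto
  qed
  then have "card P \<le> card S" using s S(1) by (intro card_inj_on_le) auto
  then show False using P(3) by simp
qed

text \<open>For the number of vertices, at least \<open>n\<close> of the paths differ from the edge
  \<open>[x, y]\<close>, and each of them has an inner vertex of its own.\<close>

lemma (in graph) k_connected_imp_no_small_separator:
  assumes "k_connected (n + 1) G"
  shows "no_small_separator (\<lambda>x y. x \<rightarrow>\<^bsub>G\<^esub> y) n (verts G)"
  unfolding no_small_separator_def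
proof (intro conjI allI impI ballI)
  let ?V = "verts G"
  have "2 \<le> card ?V" using assms by (simp add: k_connected_def)
  then obtain x y where xy: "x \<in> ?V" "y \<in> ?V" "x \<noteq> y"
    by (metis card_le_Suc0_iff_eq finite_verts not_less_eq_eq numeral_2_eq_2)
  obtain P where P: "finite P" "n + 1 \<le> card P" "internally_disjoint_paths G x y P"
    using assms xy unfolding k_connected_def by blast
  let ?S = "?V - {x, y}"
  show "n + 2 \<le> card ?V"
  proof (rule ccontr)
    assume "\<not> ?thesis"
    moreover have "card ?S = card ?V - 2" using xy by (simp add: card_Diff_subset)
    ultimately have small: "card ?S < n" using \<open>2 \<le> card ?V\<close> by simp
    have P': "internally_disjoint_paths G x y (P - {[x, y]})"
      using P(3) unfolding internally_disjoint_paths_def by blast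
    have "n \<le> card (P - {[x, y]})" using P(1,2) by (auto simp: card_Diff_singleton_if)
    then obtain p where p: "p \<in> P" "p \<noteq> [x, y]" "set p \<inter> ?S = {}"
      using disjoint_paths_avoid_set[OF P', of ?S] P(1) small by auto
    have vp: "vpath p G" "hd p = x" "last p = y"
      using P(3) p(1) unfolding internally_disjoint_paths_def by auto
    then have pp: "distinct p" "set p \<subseteq> ?V" "p \<noteq> []" by (auto simp: vpath_def vwalk_def)
    then have "set p \<subseteq> {x, y}" using p(3) by blast
    obtain q where q: "p = x # q" using vp(2) pp(3) by (cases p) auto
    then have "q \<noteq> []" using vp(3) xy(3) by auto
    then obtain r where r: "p = x # r @ [y]" using q vp(3) by (metis append_butlast_last_id last_ConsR)
    then have "r = []" using \<open>set p \<subseteq> {x, y}\<close> pp(1) by (cases r) auto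
    then show False using r p(2) by simp
  qed
next
  fix S x y assume S: "S \<subseteq> verts G" "card S \<le> n" and xy: "x \<in> verts G - S" "y \<in> verts G - S"
  show "reach (\<lambda>x y. x \<rightarrow>\<^bsub>G\<^esub> y) (verts G - S) x y"
  proof (cases "x = y")
    case False
    obtain P where P: "finite P" "n + 1 \<le> card P" "internally_disjoint_paths G x y P"
      using assms xy False unfolding k_connected_def by blast
    then obtain p where p: "p \<in> P" "set p \<inter> S = {}"
      using disjoint_paths_avoid_set[OF P(3,1), of S] S xy finite_subset[OF S(1) finite_verts] by auto
    then have "vpath p G" "hd p = x" "last p = y"
      using P(3) unfolding internally_disjoint_paths_def by auto
    then show ?thesis using vwalk_reach[of p G "verts G - S"] p(2) by (auto simp: vpath_def vwalk_def)
  qed simp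
qed

text \<open>Used in contrapositive form: a graph that does not fold onto a clique of size
  \<open>n + 2\<close> must contain one of size \<open>n + 3\<close>. Working with
  \<open>G \<restriction> U\<close> makes each fold the removal of one element of
  \<open>U\<close>.\<close>

lemma (in graph) folds_onto_complete:
  assumes ch: "chordal_relation (\<lambda>x y. x \<rightarrow>\<^bsub>G\<^esub> y)"
    and "U \<subseteq> verts G" "no_small_separator (\<lambda>x y. x \<rightarrow>\<^bsub>G\<^esub> y) n U"
    and "\<And>Q. Q \<subseteq> U \<Longrightarrow> clique (\<lambda>x y. x \<rightarrow>\<^bsub>G\<^esub> y) Q \<Longrightarrow> card Q \<noteq> n + 3"
  shows "\<exists>H. folds_onto (G \<restriction> U) H \<and> complete_digraph (n + 2) H"
proof -
  interpret C: chordal_relation "\<lambda>x y. x \<rightarrow>\<^bsub>G\<^esub> y" by (rule ch)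
  have "finite U" using assms(2) finite_subset finite_verts by blast
  then show ?thesis using assms(2-)
  proof (induction U rule: finite_psubset_induct)
    case (psubset U)
    have "n + 2 \<le> card U" using psubset.prems by (simp add: no_small_separator_def)
    then consider "card U = n + 2" | "n + 3 \<le> card U" by linarith
    then show ?case
    proof cases
      case 1
      then have "clique (\<lambda>x y. x \<rightarrow>\<^bsub>G\<^esub> y) U"
        using C.minimal_no_small_separator_clique psubset.hyps psubset.prems by blast
      then have "arcs_ends (G \<restriction> U) = {(u, v). (u, v) \<in> U \<times> U \<and> u \<noteq> v}"
        using C.irrE by (auto simp: arcs_ends_induce clique_def)
      then have "complete_digraph (n + 2) (G \<restriction> U)"
        using 1 graph_induce[OF psubset.prems(1)] by (simp add: complete_digraph_def)
      then show ?thesis unfolding folds_onto_def by blast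
    next
      case 2
      obtain u x where u: "u \<in> U" "simplicial (\<lambda>x y. x \<rightarrow>\<^bsub>G\<^esub> y) U u" "x \<in> U" "x \<noteq> u"
        "nbrs (\<lambda>x y. x \<rightarrow>\<^bsub>G\<^esub> y) U u \<subseteq> nbrs (\<lambda>x y. x \<rightarrow>\<^bsub>G\<^esub> y) U x"
        using C.ex_foldable_simplicial[OF psubset.hyps psubset.prems(2) 2 psubset.prems(3)] by blast
      have "is_fold (G \<restriction> U) (G \<restriction> (U - {u}))"
        unfolding is_fold_def
        using u by (intro bexI[of _ u] bexI[of _ x]) (auto simp: neighbours_induce del_vert_induce)
      moreover have "\<exists>H. folds_onto (G \<restriction> (U - {u})) H \<and> complete_digraph (n + 2) H"
      proof (rule psubset.IH)
        show "no_small_separator (\<lambda>x y. x \<rightarrow>\<^bsub>G\<^esub> y) n (U - {u})"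
          by (rule C.no_small_separator_remove_simplicial[OF psubset.hyps psubset.prems(2) u(1,2) 2])
        show "card Q \<noteq> n + 3" if "Q \<subseteq> U - {u}" "clique (\<lambda>x y. x \<rightarrow>\<^bsub>G\<^esub> y) Q" for Q
          using psubset.prems(3)[of Q] that by blast
      qed (use u psubset.prems in auto)
      ultimately show ?thesis
        unfolding folds_onto_def by (meson converse_rtranclp_into_rtranclp)
    qed
  qed
qed

theorem theorem5p6:
  fixes G :: "('a, 'b) pre_digraph" and n :: nat
  assumes "graph G"
    and "k_connected (n + 1) G"
    and "chordal G"
    and "\<not> (\<exists>H. folds_onto G H \<and> complete_digraph (n + 2) H)"
  shows "n_connected_space n (geometric_realization (neighbourhood_complex G))"
proof -
  interpret graph G by (rule assms(1))
  let ?E = "\<lambda>x y. x \<rightarrow>\<^bsub>G\<^esub> y"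
  interpret C: chordal_relation ?E by (rule chordal_imp_chordal_relation[OF assms(3)])
  have sep: "no_small_separator ?E n (verts G)"
    by (rule k_connected_imp_no_small_separator[OF assms(2)])
  have "G \<restriction> verts G = G" by (intro pre_digraph.equality) auto
  then obtain Q where Q: "Q \<subseteq> verts G" "clique ?E Q" "card Q = n + 3"
    using folds_onto_complete[OF C.chordal_relation_axioms order_refl sep] assms(4) by force
  \<comment> \<open>By symmetry, \<open>w\<close> is a common neighbour of the vertices of
    \<open>\<sigma>\<close> exactly if \<open>\<sigma>\<close> lies in the neighbourhood of
    \<open>w\<close>.\<close>
  have "neighbourhood_complex G = (\<Union>w\<in>verts G. Pow (nbrs ?E (verts G) w))"
    using C.symE unfolding neighbourhood_complex_def neighbours_def nbrs_def by blast
  then show ?thesis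
    using C.box_connected_neighbourhoods[OF finite_verts sep Q] by (intro n_connected_realization) simp
qed

end
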